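(* There is a set $A\subseteq\mathbb{R}$ that is a $\mathbb{Q}$-vector subspace of $\mathbb{R}$ such that $\dim_{\mathrm H} A=0$, $X_A=\mathbb{R}\setminus\mathbb{Q}$, and $A$ is a difference $F_1\setminus F_2$ of two $F_\sigma$ subsets $F_1,F_2$ of $\mathbb{R}$, and such that $$A\in\boldsymbol{\Delta}^0_3\setminus\bigl(\boldsymbol{\Sigma}^0_2\cup\boldsymbol{\Pi}^0_2\bigr),$$ i.e. $A$ is both $G_{\delta\sigma}$ and $F_{\sigma\delta}$, but neither $F_\sigma$ nor $G_\delta$.
   Context: $\dim_{\mathrm H}$ denotes Hausdorff dimension with respect to the Euclidean metric. For an additive subgroup $A$ of $\mathbb{R}$ and $\xi\in\mathbb{R}$, $A+\xi A=\{a+\xi b: a,b\in A\}$ and $X_A=\{\xi\in\mathbb{R}: A+\xi A=\mathbb{R}\}$. Boldface classes are those of the Borel hierarchy on $\mathbb{R}$: $\boldsymbol{\Sigma}^0_2=F_\sigma$, $\boldsymbol{\Pi}^0_2=G_\delta$, $\boldsymbol{\Sigma}^0_3=G_{\delta\sigma}$, $\boldsymbol{\Pi}^0_3=F_{\sigma\delta}$, and $\boldsymbol{\Delta}^0_3=\boldsymbol{\Sigma}^0_3\cap\boldsymbol{\Pi}^0_3$. *)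

theory Defs
  imports "HOL-Analysis.Analysis"
begin

global_interpretation rat_real: vector_space "\<lambda>(q::rat) (x::real). of_rat q * x"
  by unfold_locales (simp_all add: algebra_simps of_rat_add of_rat_mult)

text \<open>
  The \<open>s\<close>-th power of the diameter of a bounded set, with the conventions \<open>0^0 = 1\<close> on nonempty
  sets (whereas \<open>0 powr 0 = 0\<close>) and value \<open>0\<close> on the empty set for every \<open>s\<close>.
\<close>
definition diam_pow :: "real \<Rightarrow> 'a::metric_space set \<Rightarrow> real" where
  "diam_pow s U = (if U = {} then 0 else if s = 0 then 1 else diameter U powr s)"

text \<open>The constraint \<^term>\<open>bounded (U i)\<close> is needed because \<^const>\<open>diameter\<close> is
  unspecified on unbounded sets.\<close>
definition hausdorff_premeasure :: "real \<Rightarrow> real \<Rightarrow> 'a::metric_space set \<Rightarrow> ennreal" where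
  "hausdorff_premeasure s \<delta> A =
     (INF U \<in> {U :: nat \<Rightarrow> 'a set. A \<subseteq> (\<Union>i. U i) \<and> (\<forall>i. bounded (U i) \<and> diameter (U i) \<le> \<delta>)}.
        (\<Sum>i. ennreal (diam_pow s (U i))))"

definition hausdorff_measure :: "real \<Rightarrow> 'a::metric_space set \<Rightarrow> ennreal" where
  "hausdorff_measure s A = (SUP \<delta>\<in>{0<..}. hausdorff_premeasure s \<delta> A)"

definition hausdorff_dim :: "'a::metric_space set \<Rightarrow> ennreal" where
  "hausdorff_dim A = (INF s \<in> {s. 0 \<le> s \<and> hausdorff_measure s A = 0}. ennreal s)"

definition X_set :: "real set \<Rightarrow> real set" where
  "X_set A = {\<xi>. {a + \<xi> * b | a b. a \<in> A \<and> b \<in> A} = UNIV}"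

definition Sigma02 :: "real set set" where
  "Sigma02 = {S. fsigma S}"

definition Pi02 :: "real set set" where
  "Pi02 = {S. gdelta S}"

definition Sigma03 :: "real set set" where
  "Sigma03 = {\<Union>n. G n | G :: nat \<Rightarrow> real set. \<forall>n. G n \<in> Pi02}"

definition Pi03 :: "real set set" where
  "Pi03 = {\<Inter>n. F n | F :: nat \<Rightarrow> real set. \<forall>n. F n \<in> Sigma02}"

definition Delta03 :: "real set set" where
  "Delta03 = Sigma03 \<inter> Pi03"

end

theory Submission
  imports Defs
begin

text \<open>
  The space is the rational span \<open>A\<close> of pairs of numbers \<open>a z, b z\<close> (\<open>first_num\<close> and
  \<open>second_num\<close> below), where \<open>z\<close> runs over codes with irrational slope \<open>\<xi> z\<close>. A code lists the
  base 16 digits of its slope together with free integers \<open>t\<^sub>k\<close>; the numbers are extremely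
  lacunary series whose \<open>k\<close>-th terms form, in units of \<open>1/P\<^bsub>k+1\<^esub>\<close>, an integer vector that lies
  (up to one marking term) on a prescribed rational line: it is \<open>t\<^sub>k\<close> times \<open>(u, v)\<close>. The
  direction \<open>(u, v)\<close> at stage \<open>k\<close> is read off from the first \<open>k\<close> entries of the code.

  Why every irrational \<open>\<xi>\<close> belongs to \<open>X\<^sub>A\<close>: along a rational direction the
  form \<open>a + \<xi> b\<close> moves by \<open>t\<^sub>k (u + v \<xi>)\<close>, and \<open>u + v \<xi>\<close> is nonzero. Directions for which
  it is too small at stage \<open>k\<close> are replaced by \<open>(1, 0)\<close>; so a greedy choice of the \<open>t\<^sub>k\<close> reaches
  every small target (\<open>greedy_representation\<close>), and division by integers removes the word small.

  Why \<open>A\<close> has dimension 0: directions are assigned by an independent family, so for distinct codes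
  \<open>z\<^sub>1, \<dots>, z\<^sub>n\<close> and nonzero coefficient pairs \<open>(r\<^sub>i, s\<^sub>i)\<close> there are infinitely many stages at which the direction
  of \<open>z\<^sub>i\<close> is \<open>(s\<^sub>i, -r\<^sub>i)\<close> for all \<open>i\<close>. At such a stage each \<open>r\<^sub>i a z\<^sub>i + s\<^sub>i b z\<^sub>i\<close> has no term at all, which
  leaves a gap in the series: every element of \<open>A\<close> is approximated by rationals as well as a Liouville
  number (\<open>comb_liouville_like\<close>), and such numbers form a set of dimension 0. In particular
  \<open>sqrt 2\<close> is not in \<open>A\<close>, so \<open>A\<close> is proper and no rational lies in \<open>X\<^sub>A\<close>.

  Why \<open>A\<close> is a difference of two \<open>F\<^sub>\<sigma>\<close> sets: the condition that \<open>(s\<^sub>i, -r\<^sub>i)\<close> be used eventually is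
  only \<open>s\<^sub>i \<noteq> r\<^sub>i \<xi> z\<^sub>i\<close>. This is automatic for irrational slopes, but it makes sense for all codes, and
  codes form a compact space. Let \<open>F\<^sub>1\<close> be the set of all combinations satisfying it (together with 0),
  and \<open>F\<^sub>2\<close> the set of those in which moreover some slope is rational. Both are countable unions of
  compact sets, and \<open>A = F\<^sub>1 - F\<^sub>2\<close>. That \<open>A\<close> does not meet \<open>F\<^sub>2\<close> is a linear
  independence statement (\<open>comb_nonzero\<close>). It comes from the marking term, a multiple of
  \<open>(-\<xi>\<^sub>k, 1)\<close> with \<open>\<xi>\<^sub>k\<close> the truncated slope, which the independent family adds to one chosen code
  while the main terms of all codes cancel.

  Finally, a proper dense subgroup is not \<open>G\<^sub>\<delta>\<close>, since it would be disjoint from a coset although both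
  are comeagre; and \<open>A\<close> is not \<open>F\<^sub>\<sigma>\<close>, since otherwise \<open>X\<^sub>A\<close> would be a countable union of closed sets,
  one of which would contain an interval and hence a rational (\<open>irrational_X_set_not_fsigma\<close>).
\<close>

section \<open>Baire category and the Borel hierarchy\<close>

lemma fsigma_iff_fsigma_in: "fsigma S \<longleftrightarrow> fsigma_in euclidean S"
proof
  assume "fsigma S"
  then obtain F :: "nat \<Rightarrow> 'a set" where F: "\<And>n. closed (F n)" "S = (\<Union>n. F n)"
    by cases auto
  show "fsigma_in euclidean S"
    unfolding F(2) by (rule fsigma_in_Union) (auto intro!: closed_imp_fsigma_in F(1))
next
  assume "fsigma_in euclidean S"
  then obtain C :: "nat \<Rightarrow> 'a set" where "\<And>n. closed (C n)" "\<Union> (range C) = S"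
    unfolding fsigma_in_ascending by auto
  then show "fsigma S"
    using fsigma.intros[of C] by simp
qed

lemma gdelta_iff_gdelta_in: "gdelta S \<longleftrightarrow> gdelta_in euclidean S"
proof -
  have "gdelta S \<longleftrightarrow> fsigma (- S)"
    using gdelta_complement[of "- S"] by simp
  then show ?thesis
    by (simp add: fsigma_iff_fsigma_in gdelta_in_fsigma_in Compl_eq_Diff_UNIV)
qed

lemma fsigma_UN_closed:
  assumes "countable I" "\<And>i. i \<in> I \<Longrightarrow> closed (K i)"
  shows "fsigma (\<Union>i\<in>I. K i)"
  unfolding fsigma_iff_fsigma_in
  by (rule fsigma_in_Union) (use assms in \<open>auto intro!: closed_imp_fsigma_in\<close>)

lemma diff_fsigma_Delta03:
  assumes "fsigma F" "fsigma (H :: real set)"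
  shows "F - H \<in> Delta03"
proof -
  obtain C :: "nat \<Rightarrow> real set" where C: "\<And>n. closed (C n)" "F = (\<Union>n. C n)"
    using assms(1) by cases auto
  obtain K :: "nat \<Rightarrow> real set" where K: "\<And>n. closed (K n)" "H = (\<Union>n. K n)"
    using assms(2) by cases auto
  have "gdelta (C n - H)" for n
    unfolding gdelta_iff_gdelta_in
    by (rule gdelta_in_diff)
       (use C(1) assms(2) in \<open>auto simp: fsigma_iff_fsigma_in intro!: closed_imp_gdelta_in
          metrizable_space_euclidean\<close>)
  moreover have "F - H = (\<Union>n. C n - H)"
    using C(2) by auto
  ultimately have 1: "F - H \<in> Sigma03"
    unfolding Sigma03_def Pi02_def by (intro CollectI exI[of _ "\<lambda>n. C n - H"]) auto
  have "fsigma (F - K n)" for n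
    unfolding fsigma_iff_fsigma_in
    by (rule fsigma_in_diff)
       (use K(1) assms(1) in \<open>auto simp: fsigma_iff_fsigma_in intro!: closed_imp_gdelta_in
          metrizable_space_euclidean\<close>)
  moreover have "F - H = (\<Inter>n. F - K n)"
    using K(2) by auto
  ultimately have 2: "F - H \<in> Pi03"
    unfolding Pi03_def Sigma02_def by (intro CollectI exI[of _ "\<lambda>n. F - K n"]) auto
  from 1 2 show ?thesis
    by (simp add: Delta03_def)
qed

text \<open>
  The subgroup and its coset by \<open>c\<close> would be two dense \<open>G\<^sub>\<delta>\<close> sets, so by Baire they would meet;
  cosets are disjoint.
\<close>
lemma proper_dense_subgroup_not_gdelta:
  fixes A :: "real set"
  assumes diff: "\<And>x y. x \<in> A \<Longrightarrow> y \<in> A \<Longrightarrow> x - y \<in> A"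
    and c: "c \<notin> A" and dense: "closure A = UNIV"
  shows "\<not> gdelta A"
proof
  assume "gdelta A"
  then obtain G :: "nat \<Rightarrow> real set" where G: "\<And>n. open (G n)" "A = (\<Inter>n. G n)"
    by cases auto
  define \<G> where "\<G> = range G \<union> range (\<lambda>n. (+) c ` G n)"
  have dG: "closure (G n) = UNIV" for n
    using closure_mono[of A "G n"] G(2) dense by auto
  have "UNIV \<subseteq> closure (\<Inter>\<G>)"
  proof (rule Baire)
    fix T assume "T \<in> \<G>"
    then show "openin (top_of_set UNIV) T \<and> UNIV \<subseteq> closure T"
      using G(1) dG by (auto simp: \<G>_def closure_translation intro: open_translation)
  qed (auto simp: \<G>_def)
  then obtain x where "x \<in> \<Inter>\<G>"
    by (metis UNIV_I closure_empty ex_in_conv subset_empty UNIV_not_empty)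
  then have "x \<in> A" "\<And>n. x \<in> (+) c ` G n"
    unfolding G(2) \<G>_def by auto
  then have "\<And>n. x - c \<in> G n"
    by (metis add_diff_cancel_left' imageE)
  then have "x - c \<in> A"
    using G(2) by auto
  from diff[OF \<open>x \<in> A\<close> this] c show False by simp
qed

lemma baire_union_UNIV:
  fixes C :: "'i \<Rightarrow> real set"
  assumes "countable I" "\<And>i. i \<in> I \<Longrightarrow> closed (C i)" "(\<Union>i\<in>I. C i) = UNIV"
  obtains i where "i \<in> I" "interior (C i) \<noteq> {}"
proof (rule ccontr)
  assume "\<not> thesis"
  then have I: "\<And>i. i \<in> I \<Longrightarrow> interior (C i) = {}"
    using that by blast
  have "UNIV \<subseteq> closure (\<Inter>((\<lambda>i. - C i) ` I))"
  proof (rule Baire)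
    fix T assume "T \<in> (\<lambda>i. - C i) ` I"
    then show "openin (top_of_set UNIV) T \<and> UNIV \<subseteq> closure T"
      using assms(2) I by (auto simp: closure_complement open_Compl)
  qed (use assms(1) in auto)
  moreover have "\<Inter>((\<lambda>i. - C i) ` I) = {}"
    using assms(3) by blast
  ultimately show False by simp
qed

text \<open>
  By compactness, a limit of parameters for which a point is represented still represents it.
\<close>
lemma closed_covering_parameters:
  fixes K L I :: "real set"
  assumes "compact K" "compact L"
  shows "closed {\<xi>. I \<subseteq> {a + \<xi> * b | a b. a \<in> K \<and> b \<in> L}}"
proof -
  have "closed {\<xi>. x \<in> {a + \<xi> * b | a b. a \<in> K \<and> b \<in> L}}" for x
    unfolding closed_sequential_limits
  proof (intro allI impI, elim conjE)
    fix \<xi> :: "nat \<Rightarrow> real" and l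
    assume "\<forall>n. \<xi> n \<in> {\<xi>. x \<in> {a + \<xi> * b |a b. a \<in> K \<and> b \<in> L}}" and l: "\<xi> \<longlonglongrightarrow> l"
    then have "\<forall>n. \<exists>p. p \<in> K \<times> L \<and> x = fst p + \<xi> n * snd p" by fastforce
    then obtain p where p: "\<And>n. p n \<in> K \<times> L" "\<And>n. x = fst (p n) + \<xi> n * snd (p n)"
      by metis
    have "compact (K \<times> L)" using assms by (rule compact_Times)
    then obtain q r where q: "q \<in> K \<times> L" "strict_mono r" "(p \<circ> r) \<longlonglongrightarrow> q"
      using p(1) unfolding compact_def by metis
    have "(\<lambda>n. fst ((p \<circ> r) n) + (\<xi> \<circ> r) n * snd ((p \<circ> r) n)) \<longlonglongrightarrow> fst q + l * snd q"
      using q(3) LIMSEQ_subseq_LIMSEQ[OF l q(2)] by (intro tendsto_intros)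
    moreover have "(\<lambda>n. fst ((p \<circ> r) n) + (\<xi> \<circ> r) n * snd ((p \<circ> r) n)) = (\<lambda>n. x)"
      using p(2) by auto
    ultimately have "x = fst q + l * snd q"
      by (simp add: LIMSEQ_const_iff)
    then show "l \<in> {\<xi>. x \<in> {a + \<xi> * b |a b. a \<in> K \<and> b \<in> L}}"
      using q(1) by (auto simp: mem_Times_iff)
  qed
  moreover have "{\<xi>. I \<subseteq> {a + \<xi> * b | a b. a \<in> K \<and> b \<in> L}}
      = (\<Inter>x\<in>I. {\<xi>. x \<in> {a + \<xi> * b | a b. a \<in> K \<and> b \<in> L}})"
    by blast
  ultimately show ?thesis by auto
qed

lemma rat_subspace_with_interval:
  assumes A: "rat_real.subspace A" and I: "{x. \<bar>x - c\<bar> < e} \<subseteq> A" "e > 0"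
  shows "A = UNIV"
proof -
  have "y \<in> A" for y :: real
  proof -
    obtain n :: nat where n: "\<bar>y\<bar> / e < real n" "n > 0"
      by (metis gr0I of_nat_0 reals_Archimedean2 abs_ge_zero divide_nonneg_pos I(2) not_less)
    have "\<bar>y / real n\<bar> < e"
      using n I(2) by (simp add: field_simps abs_mult)
    then have "c + y / real n \<in> A" "c \<in> A"
      using I by auto
    then have "c + y / real n - c \<in> A"
      using A by (rule rat_real.subspace_diff[rotated])
    then have "of_rat (of_nat n) * (y / real n) \<in> A"
      using A rat_real.subspace_scale[of A "y / real n" "of_nat n"] by simp
    then show ?thesis using n by simp
  qed
  then show ?thesis by auto
qed

text \<open>
  Write \<open>A\<close> as a union of compact sets \<open>K m\<close>. For irrational \<open>\<xi>\<close> the countably many compact sets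
  \<open>K m + \<xi> K n\<close> cover the line, so one of them contains an interval \<open>I\<close> with rational data.
  Thus the closed sets \<open>{\<xi>. I \<subseteq> K m + \<xi> K n}\<close> together with the rational points cover
  the line. Baire applied a second time, now to the parameter, gives a closed set of this kind that
  contains a rational \<open>q\<close>; then \<open>A \<supseteq> K m + q K n\<close> contains an interval, which forces \<open>A = UNIV\<close>.
\<close>
lemma irrational_X_set_not_fsigma:
  assumes A: "rat_real.subspace A" and X: "X_set A = UNIV - \<rat>"
  shows "\<not> fsigma A"
proof
  assume "fsigma A"
  then obtain K :: "nat \<Rightarrow> real set" where K: "\<And>n. compact (K n)" "A = (\<Union>n. K n)"
    unfolding fsigma_Union_compact by (auto simp: image_subset_iff)
  define I where "I = (\<lambda>(c, d). {x. \<bar>x - real_of_rat c\<bar> \<le> real_of_rat d})"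
  define C where "C = (\<lambda>(m, n, i). {\<xi>. I i \<subseteq> {a + \<xi> * b | a b. a \<in> K m \<and> b \<in> K n}})"
  define J :: "(nat \<times> nat \<times> rat \<times> rat) set" where "J = {(m, n, c, d). d > 0}"
  have closedC: "closed (C i)" for i
    unfolding C_def by (cases i) (simp add: closed_covering_parameters K)
  define E where "E s = (case s of Inl i \<Rightarrow> C i | Inr q \<Rightarrow> {real_of_rat q})" for s
  have "closed (E s)" for s
    unfolding E_def using closedC by (cases s) auto
  moreover have "countable (J <+> (UNIV :: rat set))" by simp
  moreover have "(\<Union>s\<in>J <+> (UNIV :: rat set). E s) = UNIV"
  proof -
    have "\<exists>i\<in>J. \<xi> \<in> C i" if "\<xi> \<notin> \<rat>" for \<xi>
    proof -
      define S where "S = (\<lambda>(m, n). {a + \<xi> * b | a b. a \<in> K m \<and> b \<in> K n})"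
      have S: "closed (S mn)" for mn
      proof (cases mn)
        case (Pair m n)
        have "S mn = {x + y | x y. x \<in> K m \<and> y \<in> (*) \<xi> ` K n}"
          unfolding Pair S_def by auto
        moreover have "compact ((*) \<xi> ` K n)"
          by (intro compact_continuous_image continuous_intros K)
        ultimately show ?thesis
          using compact_sums[OF K(1)[of m]] by (simp add: compact_imp_closed)
      qed
      have "\<xi> \<in> X_set A" using X that by auto
      then have "UNIV = {a + \<xi> * b | a b. a \<in> A \<and> b \<in> A}" by (simp add: X_set_def)
      also have "\<dots> = (\<Union>mn\<in>UNIV. S mn)"
        unfolding K(2) S_def by auto
      finally obtain mn where "interior (S mn) \<noteq> {}"
        using baire_union_UNIV[of UNIV S] S by (metis countableI_type)
      then obtain y e where e: "e > 0" "ball y e \<subseteq> S mn"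
        by (meson ex_in_conv mem_interior)
      obtain c where c: "y < real_of_rat c" "real_of_rat c < y + e / 2"
        using of_rat_dense[of y "y + e/2"] e by auto
      obtain d where d: "0 < real_of_rat d" "real_of_rat d < e / 2"
        using of_rat_dense[of 0 "e/2"] e by auto
      have "I (c, d) \<subseteq> ball y e"
        using c d unfolding I_def by (auto simp: dist_real_def abs_le_iff)
      then have "\<xi> \<in> C (fst mn, snd mn, c, d)"
        using e unfolding C_def S_def by (auto split: prod.splits)
      moreover have "(fst mn, snd mn, c, d) \<in> J"
        using d by (simp add: J_def)
      ultimately show ?thesis by blast
    qed
    then have "\<exists>s\<in>J <+> UNIV. \<xi> \<in> E s" for \<xi>
      by (cases "\<xi> \<in> \<rat>") (force simp: E_def elim!: Rats_cases)+
    then show ?thesis by blast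
  qed
  ultimately obtain s where "s \<in> J <+> (UNIV :: rat set)" "interior (E s) \<noteq> {}"
    using baire_union_UNIV[of "J <+> (UNIV :: rat set)" E] by metis
  then obtain i where i: "i \<in> J" "interior (C i) \<noteq> {}"
    by (cases s; simp add: E_def; blast)
  obtain m n c d where mn: "i = (m, n, c, d)" by (cases i)
  from i obtain y e where e: "e > 0" "ball y e \<subseteq> C i"
    by (meson ex_in_conv mem_interior)
  obtain q where q: "y < real_of_rat q" "real_of_rat q < y + e"
    using of_rat_dense[of y "y + e"] e by auto
  then have "real_of_rat q \<in> C i"
    using e by (auto simp: dist_real_def subset_iff)
  then have "I (c, d) \<subseteq> {a + real_of_rat q * b | a b. a \<in> K m \<and> b \<in> K n}"
    by (simp add: C_def mn)
  also have "\<dots> \<subseteq> A"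
    using A K(2) by (auto intro!: rat_real.subspace_add rat_real.subspace_scale)
  finally have "A = UNIV"
    using i(1) by (intro rat_subspace_with_interval[OF A, of "real_of_rat c" "real_of_rat d"])
      (auto simp: I_def J_def mn)
  then have "0 \<in> X_set A"
    unfolding X_set_def by auto
  then show False using X by auto
qed


section \<open>Liouville-like numbers have dimension zero\<close>
text \<open>
  The Liouville condition, with rational numbers not excluded. The bound on the numerator only
  restricts the size of \<open>x\<close> in terms of \<open>q\<close>; it makes the number of fractions with a given
  denominator finite, so that no cutting into bounded parts is required.
\<close>
definition liouville_like :: "real \<Rightarrow> bool" where
  "liouville_like x \<longleftrightarrow>
     (\<forall>n. \<exists>q::nat. q \<ge> n \<and> (\<exists>p::int. \<bar>p\<bar> \<le> int q ^ 2 \<and> \<bar>x - p / q\<bar> \<le> 1 / real q ^ n))"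

lemma suminf_inverse_squares_tail:
  assumes "n > 0" and that: "c \<ge> 0"
  shows "(\<Sum>i. ennreal (c / real (n + 1 + i) ^ 2)) \<le> ennreal (c / real n)"
proof (rule suminf_le_const)
  show "summable (\<lambda>i. ennreal (c / real (n + 1 + i) ^ 2))" by simp
  fix N
  have "(\<Sum>i<N. c / real (n + 1 + i) ^ 2) \<le> c / n - c / (n + N)"
  proof (induction N)
    case (Suc N)
    have "c / real (n + 1 + N) ^ 2 \<le> c / (real (n + N) * real (n + 1 + N))"
      using assms that by (intro divide_left_mono) (auto simp: power2_eq_square)
    also have "\<dots> = c / (n + N) - c / (n + Suc N)"
      using assms by (simp add: field_simps)
    finally show ?case using Suc by simp
  qed simp
  also have "\<dots> \<le> c / n" using that by simp
  finally show "(\<Sum>i<N. ennreal (c / real (n + 1 + i) ^ 2)) \<le> ennreal (c / real n)"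
    using that by (subst sum_ennreal) (auto intro!: ennreal_leI)
qed

text \<open>
  Cover by the intervals of radius \<open>q ^ (-n)\<close> around the at most \<open>2 q\<^sup>2 + 1\<close> fractions of
  denominator \<open>q\<close>, for all \<open>q > n\<close>. Once \<open>(n - 1) s \<ge> 4\<close>, denominator \<open>q\<close> contributes at most
  \<open>3 / q\<^sup>2\<close>.
\<close>
lemma liouville_premeasure:
  assumes A: "\<And>x. x \<in> A \<Longrightarrow> liouville_like x" and s: "s > 0" and \<delta>: "\<delta> > 0"
    and n: "n \<ge> 2" "(real n - 1) * s \<ge> 4" "2 / real n \<le> \<delta>"
  shows "hausdorff_premeasure s \<delta> A \<le> ennreal (3 / real n)"
proof -
  define U :: "nat \<times> nat \<Rightarrow> real set" where "U = (\<lambda>(i, j). let q = n + 1 + i in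
    if j \<le> 2 * q ^ 2 then cball ((real j - real q ^ 2) / real q) (1 / real q ^ n) else {})"
  have cover: "A \<subseteq> (\<Union>i. U (prod_decode i))"
  proof
    fix x assume "x \<in> A"
    then obtain q :: nat and p :: int where q: "q \<ge> n + 1" "\<bar>p\<bar> \<le> int q ^ 2"
      "\<bar>x - p / q\<bar> \<le> 1 / real q ^ (n + 1)"
      using A unfolding liouville_like_def by meson
    \<comment> \<open>The shift by \<open>q\<^sup>2\<close> turns the integer numerator into a natural index.\<close>
    define j where "j = nat (p + int q ^ 2)"
    have j: "int j = p + int q ^ 2" using q(2) by (simp add: j_def abs_le_iff)
    have jl: "j \<le> 2 * q ^ 2"
      using q(2) j by (simp flip: of_nat_le_iff[where 'a = int])
    have jr: "real j - real q ^ 2 = p"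
      using arg_cong[OF j, of real_of_int] by simp
    have "1 / real q ^ (n + 1) \<le> 1 / real q ^ n"
      using q(1) by (intro divide_left_mono power_increasing) auto
    then have "x \<in> U (q - (n + 1), j)"
      using q jl jr by (simp add: U_def dist_real_def abs_minus_commute)
    then show "x \<in> (\<Union>i. U (prod_decode i))"
      by (metis UN_I UNIV_I prod_encode_inverse)
  qed
  have small: "2 / real q ^ n \<le> \<delta>" "(2 / real q ^ n) powr s \<le> 1 / real q ^ 4" if "q > n" for q :: nat
  proof -
    have q: "real q \<ge> real n" "real q \<ge> 2" using that n(1) by auto
    have *: "real q ^ 1 \<le> real q ^ n" using q n(1) by (intro power_increasing) auto
    have "2 / real q ^ n \<le> 2 / real n"
      using * q n(1) by (intro divide_left_mono) auto
    then show "2 / real q ^ n \<le> \<delta>" using n(3) by simp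
    have "2 / real q ^ n \<le> 1 / real q ^ (n - 1)"
      using q n(1) power_Suc[of "real q" "n - 1"] by (simp add: field_simps)
    also have "\<dots> = real q powr (- (real n - 1))"
      unfolding powr_minus
      using q n(1) by (simp add: powr_realpow[symmetric] of_nat_diff divide_inverse)
    finally have "(2 / real q ^ n) powr s \<le> (real q powr (- (real n - 1))) powr s"
      using s q by (intro powr_mono2) auto
    also have "\<dots> = real q powr (- ((real n - 1) * s))"
      by (simp only: powr_powr mult_minus_left)
    also have "\<dots> \<le> real q powr (- 4)"
      using q n(2) by (intro powr_mono) auto
    also have "\<dots> = 1 / real q ^ 4"
      using q powr_realpow[of "real q" 4] by (simp add: powr_minus divide_inverse)
    finally show "(2 / real q ^ n) powr s \<le> 1 / real q ^ 4" .
  qed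
  have U: "bounded (U ij) \<and> diameter (U ij) \<le> \<delta>" for ij
    using small(1)[of "n + 1 + fst ij"] \<delta>
    by (cases ij) (auto simp: U_def Let_def)
  have "hausdorff_premeasure s \<delta> A \<le> (\<Sum>i. ennreal (diam_pow s (U (prod_decode i))))"
    unfolding hausdorff_premeasure_def
    by (rule INF_lower2[of "\<lambda>i. U (prod_decode i)"]) (use cover U in auto)
  also have "\<dots> = (\<Sum>i. \<Sum>j. ennreal (diam_pow s (U (i, j))))"
    by (rule suminf_ennreal_2dimen[where f = "\<lambda>ij. ennreal (diam_pow s (U ij))"]) simp
  also have "\<dots> \<le> (\<Sum>i. ennreal (3 / real (n + 1 + i) ^ 2))"
  proof (rule suminf_le)
    fix i
    define q where "q = n + 1 + i"
    have q: "q > n" "real q \<ge> 1" by (auto simp: q_def)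
    have "(\<Sum>j. ennreal (diam_pow s (U (i, j)))) = (\<Sum>j\<le>2 * q ^ 2. ennreal (diam_pow s (U (i, j))))"
      by (rule suminf_finite) (auto simp: U_def q_def diam_pow_def)
    also have "\<dots> \<le> (\<Sum>j\<le>2 * q ^ 2. ennreal (1 / real q ^ 4))"
    proof (intro sum_mono ennreal_leI)
      fix j assume "j \<in> {..2 * q ^ 2}"
      then have "U (i, j) = cball ((real j - real q ^ 2) / real q) (1 / real q ^ n)"
        by (simp add: U_def q_def)
      then show "diam_pow s (U (i, j)) \<le> 1 / real q ^ 4"
        using small(2)[OF q(1)] s by (simp add: diam_pow_def)
    qed
    also have "\<dots> = ennreal (\<Sum>j\<le>2 * q ^ 2. 1 / real q ^ 4)"
      by (rule sum_ennreal) auto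
    also have "\<dots> = ennreal ((2 * real q ^ 2 + 1) * (1 / real q ^ 4))"
      by (simp add: algebra_simps)
    also have "\<dots> \<le> ennreal (3 / real q ^ 2)"
    proof (rule ennreal_leI)
      have "1 \<le> real q ^ 2" using q by (intro one_le_power) auto
      then have "(2 * real q ^ 2 + 1) * (1 / real q ^ 4) \<le> (3 * real q ^ 2) * (1 / real q ^ 4)"
        by (intro mult_right_mono) auto
      also have "\<dots> = 3 / real q ^ 2"
        using q by (simp add: field_simps eval_nat_numeral)
      finally show "(2 * real q ^ 2 + 1) * (1 / real q ^ 4) \<le> 3 / real q ^ 2" .
    qed
    finally show "(\<Sum>j. ennreal (diam_pow s (U (i, j)))) \<le> ennreal (3 / real (n + 1 + i) ^ 2)"
      by (simp add: q_def)
  qed auto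
  also have "\<dots> \<le> ennreal (3 / real n)"
    using n(1) by (intro suminf_inverse_squares_tail) auto
  finally show ?thesis .
qed

lemma liouville_hausdorff_dim:
  assumes A: "\<And>x. x \<in> A \<Longrightarrow> liouville_like x"
  shows "hausdorff_dim A = 0"
proof -
  have null: "hausdorff_measure s A = 0" if s: "s > 0" for s
  proof -
    have "hausdorff_premeasure s \<delta> A = 0" if \<delta>: "\<delta> > 0" for \<delta>
    proof -
      have "hausdorff_premeasure s \<delta> A \<le> 0 + ennreal e" if "e > 0" for e
      proof -
        obtain n :: nat where n: "real n > max (max 2 (4 / s + 1)) (max (2 / \<delta>) (3 / e))"
          using reals_Archimedean2 by blast
        have "hausdorff_premeasure s \<delta> A \<le> ennreal (3 / real n)"
          by (rule liouville_premeasure[OF A s \<delta>]) (use n s \<delta> in \<open>auto simp: field_simps\<close>)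
        also have "\<dots> \<le> ennreal e"
          using n that by (intro ennreal_leI) (auto simp: field_simps)
        finally show ?thesis by simp
      qed
      then have "hausdorff_premeasure s \<delta> A \<le> 0"
        by (rule ennreal_le_epsilon)
      then show ?thesis by simp
    qed
    then show ?thesis
      by (auto simp: hausdorff_measure_def)
  qed
  have "hausdorff_dim A \<le> 0 + ennreal e" if "e > 0" for e
    unfolding hausdorff_dim_def using null[of e] that by (intro INF_lower2[of e]) auto
  then have "hausdorff_dim A \<le> 0"
    by (rule ennreal_le_epsilon)
  then show ?thesis by simp
qed

lemma square_eq_twice_square:
  fixes p q :: nat
  assumes "p ^ 2 = 2 * q ^ 2"
  shows "q = 0"
  using assms
proof (induction q arbitrary: p rule: less_induct)
  case (less q)
  show ?case
  proof (rule ccontr)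
    assume q: "q \<noteq> 0"
    have "even (p ^ 2)" using less.prems by simp
    then obtain k where k: "p = 2 * k" by (auto elim: evenE)
    then have e: "q ^ 2 = 2 * k ^ 2" using less.prems by (simp add: power2_eq_square)
    have "k < q"
    proof (rule ccontr)
      assume "\<not> k < q"
      then have "q ^ 2 \<le> k ^ 2" by (intro power_mono) auto
      with e q show False by simp
    qed
    from less.IH[OF this e] e q show False by simp
  qed
qed

text \<open>
  The classical bound \<open>\<bar>p\<^sup>2 - 2 q\<^sup>2\<bar> \<ge> 1\<close> contradicts an approximation of order 5.
\<close>
lemma sqrt2_not_liouville_like: "\<not> liouville_like (sqrt 2)"
proof
  assume "liouville_like (sqrt 2)"
  then obtain q :: nat and p :: int where q: "q \<ge> 5" "\<bar>sqrt 2 - p / q\<bar> \<le> 1 / real q ^ 5"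
    unfolding liouville_like_def by meson
  define \<epsilon> where "\<epsilon> = sqrt 2 * q - p"
  have q5: "real q \<ge> 5" using q(1) by simp
  have "\<bar>\<epsilon>\<bar> = real q * \<bar>sqrt 2 - p / q\<bar>"
    using q5 by (simp add: \<epsilon>_def abs_mult_pos' [symmetric] field_simps)
  also have "\<dots> \<le> real q * (1 / real q ^ 5)"
    using q by (intro mult_left_mono) auto
  also have "\<dots> = 1 / real q ^ 4"
    using q5 by (simp add: field_simps eval_nat_numeral)
  finally have e: "\<bar>\<epsilon>\<bar> \<le> 1 / real q ^ 4" .
  have e2: "1 / real q ^ 4 \<le> 1 / real q ^ 2"
    using q5 by (intro divide_left_mono power_increasing) auto
  also have "\<dots> \<le> 1"
    using q5 by (simp add: power2_eq_square mult_ge1_I)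
  finally have e1: "\<bar>\<epsilon>\<bar> \<le> 1 / real q ^ 2" "\<bar>\<epsilon>\<bar> \<le> 1" using e e2 by auto
  have s2: "sqrt 2 \<le> 3 / 2" by (rule real_le_lsqrt) (auto simp: power2_eq_square)
  have "p ^ 2 \<noteq> 2 * int q ^ 2"
  proof
    assume *: "p ^ 2 = 2 * int q ^ 2"
    have "int (nat \<bar>p\<bar> ^ 2) = int (2 * q ^ 2)" using * by simp
    then have "q = 0" using square_eq_twice_square[of "nat \<bar>p\<bar>" q] by linarith
    with q show False by simp
  qed
  then have "1 \<le> \<bar>2 * int q ^ 2 - p ^ 2\<bar>" by linarith
  then have "1 \<le> \<bar>2 * real q ^ 2 - real_of_int p ^ 2\<bar>"
    by (metis (mono_tags) of_int_1_le_iff of_int_abs of_int_diff of_int_mult of_int_numeral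
        of_int_of_nat_eq of_int_power)
  also have "2 * real q ^ 2 - real_of_int p ^ 2 = \<epsilon> * (2 * (sqrt 2 * q) - \<epsilon>)"
    by (simp add: \<epsilon>_def algebra_simps power2_eq_square)
  also have "\<bar>\<dots>\<bar> \<le> 1 / real q ^ 2 * (4 * real q)"
    unfolding abs_mult
  proof (rule mult_mono)
    have "sqrt 2 * q \<le> 3 / 2 * q" using s2 by (intro mult_right_mono) auto
    moreover have "0 \<le> sqrt 2 * q" by simp
    ultimately show "\<bar>2 * (sqrt 2 * q) - \<epsilon>\<bar> \<le> 4 * real q"
      using e1(2) q5 by linarith
  qed (use e1 in auto)
  also have "\<dots> = 4 / real q" using q5 by (simp add: power2_eq_square)
  finally show False using q5 by (simp add: field_simps)
qed

section \<open>Lacunary series\<close>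
text \<open>
  The denominators grow so fast that each one exceeds every fixed power of its predecessor:
  the exponent \<open>k + 4\<close> in \<open>scale (Suc k) = scale k ^ (k + 4)\<close> tends to infinity.
\<close>
definition scale :: "nat \<Rightarrow> nat" where
  "scale k = 2 ^ fact (k + 3)"

definition ratio :: "nat \<Rightarrow> nat" where
  "ratio k = scale k ^ (k + 3)"

lemma fact_step: "fact (Suc k + 3) = (k + 4) * (fact (k + 3) :: nat)"
proof -
  have "Suc k + 3 = Suc (k + 3)" by simp
  then show ?thesis by (simp only: fact_Suc) simp
qed

lemma scale_Suc: "scale (Suc k) = ratio k * scale k"
proof -
  have "fact (Suc k + 3) = fact (k + 3) * (k + 3) + (fact (k + 3) :: nat)"
    unfolding fact_step by (simp add: algebra_simps)
  then show ?thesis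
    by (simp only: scale_def ratio_def power_add power_mult)
qed

lemma scale_pos [simp]: "scale k > 0"
  by (simp add: scale_def)

lemma scale_nonzero [simp]: "scale k \<noteq> 0"
  by (simp add: scale_def)

lemma scale_ge: "8 ^ (k + 2) \<le> scale k"
proof -
  have "3 * (k + 2) \<le> (fact (k + 3) :: nat)"
  proof (induction k)
    case (Suc k)
    have "4 * (fact (k + 3) :: nat) \<le> (k + 4) * fact (k + 3)"
      by (intro mult_right_mono) auto
    moreover have "3 * (Suc k + 2) \<le> 4 * (fact (k + 3) :: nat)"
    proof -
      have "3 * (Suc k + 2) \<le> 4 * F" if "3 * (k + 2) \<le> F" for F :: nat
        using that by presburger
      then show ?thesis using Suc .
    qed
    ultimately show ?case unfolding fact_step by (rule order_trans[rotated])
  qed (simp add: eval_nat_numeral)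
  then have "(2::nat) ^ (3 * (k + 2)) \<le> scale k"
    unfolding scale_def by (intro power_increasing) auto
  then show ?thesis by (simp only: power_mult) simp
qed

lemma ratio_ge: "8 ^ (k + 2) \<le> ratio k" "64 ^ (k + 2) \<le> ratio k"
proof -
  have "scale k ^ 2 \<le> ratio k"
    unfolding ratio_def by (intro power_increasing) (auto simp: Suc_le_eq)
  moreover have "(8 ^ (k + 2)) ^ 2 \<le> scale k ^ 2"
    by (intro power_mono scale_ge) auto
  ultimately have "(8 ^ (k + 2)) ^ 2 \<le> ratio k" by linarith
  also have "(8 ^ (k + 2)) ^ 2 = ((8::nat) ^ 2) ^ (k + 2)"
    by (simp only: power_mult[symmetric] mult.commute)
  finally show *: "64 ^ (k + 2) \<le> ratio k" by simp
  have "(8::nat) ^ (k + 2) \<le> 64 ^ (k + 2)" by (intro power_mono) auto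
  then show "8 ^ (k + 2) \<le> ratio k" using * by linarith
qed

lemma le_scale: "k \<le> scale k"
proof -
  have "k \<le> 8 ^ (k + 2)"
    using less_exp[of k] power_mono[of "2::nat" 8 k] power_increasing[of k "k + 2" "8::nat"] by linarith
  then show ?thesis using scale_ge[of k] by linarith
qed

text \<open>
  The allowed size of the numerators is much larger than 1 but keeps the \<open>k\<close>-th term
  below \<open>M * 8 ^ (k + 1) / scale k\<close>: the terms of stage \<open>k\<close> refine numbers already known
  up to about \<open>1 / scale k\<close>.
\<close>
definition lacunary :: "real \<Rightarrow> (nat \<Rightarrow> int) \<Rightarrow> bool" where
  "lacunary M W \<longleftrightarrow> (\<forall>k. \<bar>real_of_int (W k)\<bar> \<le> M * 8 ^ (k + 1) * ratio k)"

definition series_val :: "(nat \<Rightarrow> int) \<Rightarrow> real" where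
  "series_val W = (\<Sum>k. W k / scale (Suc k))"

definition gauge :: "nat \<Rightarrow> real" where
  "gauge k = 8 ^ (k + 1) / scale k"

lemma gauge_pos: "gauge k > 0"
  by (simp add: gauge_def)

lemma gauge_decay: "gauge (k + j) \<le> gauge k * (1 / 2) ^ j"
proof (induction j)
  case (Suc j)
  define i where "i = k + j"
  have "(16::nat) \<le> 8 ^ 2" by simp
  also have "\<dots> \<le> 8 ^ (i + 2)" by (intro power_increasing) auto
  also have "\<dots> \<le> ratio i" by (rule ratio_ge)
  finally have r: "real (ratio i) \<ge> 16" by simp
  have "gauge (Suc i) = gauge i * (8 / ratio i)"
    by (simp add: gauge_def scale_Suc)
  also have "\<dots> \<le> gauge i * (1 / 2)"
    using r gauge_pos[of i] by (intro mult_left_mono) (auto simp: field_simps)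
  finally show ?case using Suc by (simp add: i_def)
qed simp

lemma lacunary_nonneg:
  assumes "lacunary M W" shows "0 \<le> M"
proof -
  have "0 \<le> M * (8 ^ (0 + 1) * real (ratio 0))"
    using assms[unfolded lacunary_def, rule_format, of 0] by (simp add: mult.assoc)
  moreover have "0 < 8 ^ (0 + 1) * real (ratio 0)"
    by (simp add: ratio_def)
  ultimately show ?thesis
    by (simp add: zero_le_mult_iff)
qed

lemma lacunary_term:
  assumes "lacunary M W"
  shows "\<bar>W k / scale (Suc k)\<bar> \<le> M * gauge k"
proof -
  have "ratio k > 0" by (simp add: ratio_def)
  then show ?thesis
    using assms[unfolded lacunary_def, rule_format, of k]
    by (simp add: gauge_def scale_Suc abs_mult field_simps)
qed

lemma lacunary_tail:
  assumes "lacunary M W"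
  shows "summable (\<lambda>j. W (j + k) / scale (Suc (j + k)))"
    and "\<bar>\<Sum>j. W (j + k) / scale (Suc (j + k))\<bar> \<le> 2 * M * gauge k"
proof -
  define f where "f j = W (j + k) / scale (Suc (j + k))" for j
  define g where "g j = M * gauge k * (1 / 2) ^ j" for j
  have fg: "norm (f j) \<le> g j" for j
  proof -
    have "norm (f j) \<le> M * gauge (k + j)"
      using lacunary_term[OF assms, of "k + j"] by (simp add: f_def add.commute)
    also have "\<dots> \<le> M * (gauge k * (1 / 2) ^ j)"
      by (intro mult_left_mono gauge_decay lacunary_nonneg[OF assms])
    finally show ?thesis by (simp add: g_def)
  qed
  have g: "g sums (M * gauge k * 2)"
    unfolding g_def using geometric_sums[of "1 / 2 :: real"] by (intro sums_mult) simp
  have sf: "summable (\<lambda>j. norm (f j))"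
    by (rule summable_comparison_test'[OF sums_summable[OF g], of 0]) (use fg in auto)
  then show "summable (\<lambda>j. W (j + k) / scale (Suc (j + k)))"
    using summable_norm_cancel[OF sf] by (simp add: f_def)
  have "norm (suminf f) \<le> suminf g"
    by (rule norm_suminf_le[OF fg sums_summable[OF g]])
  then show "\<bar>\<Sum>j. W (j + k) / scale (Suc (j + k))\<bar> \<le> 2 * M * gauge k"
    using sums_unique[OF g] by (simp add: f_def[abs_def] mult.commute mult.left_commute)
qed

lemma lacunary_summable:
  "lacunary M W \<Longrightarrow> summable (\<lambda>k. W k / scale (Suc k))"
  using lacunary_tail(1)[of M W 0] by simp

lemma partial_sum_in_lattice:
  "\<exists>p::int. (\<Sum>j<k. W j / scale (Suc j)) = p / scale k" for W :: "nat \<Rightarrow> int"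
proof (induction k)
  case (Suc k)
  then obtain p :: int where p: "(\<Sum>j<k. W j / scale (Suc j)) = p / scale k" by blast
  have "ratio k > 0" by (simp add: ratio_def)
  then have "(\<Sum>j<Suc k. W j / scale (Suc j)) = of_int (p * int (ratio k) + W k) / scale (Suc k)"
    using p by (simp add: scale_Suc field_simps)
  then show ?case by blast
qed (auto intro: exI[of _ 0])

lemma series_val_split:
  assumes "lacunary M W"
  obtains p :: int and t where
    "series_val W = p / scale k + W k / scale (Suc k) + t" "\<bar>t\<bar> \<le> 2 * M * gauge (Suc k)"
proof -
  obtain p :: int where p: "(\<Sum>j<k. W j / scale (Suc j)) = p / scale k"
    using partial_sum_in_lattice by blast
  show ?thesis
  proof (rule that)
    show "series_val W = p / scale k + W k / scale (Suc k)
        + (\<Sum>j. W (j + Suc k) / scale (Suc (j + Suc k)))"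
      unfolding series_val_def
      using suminf_split_initial_segment[OF lacunary_summable[OF assms], of "Suc k"] p by simp
  qed (rule lacunary_tail(2)[OF assms])
qed

lemma gauge_Suc_le: "gauge (Suc k) \<le> scale k / scale (Suc k)"
proof -
  have "real (8 ^ (k + 2)) \<le> real (scale k)"
    using scale_ge by (simp only: of_nat_le_iff)
  then show ?thesis
    unfolding gauge_def by (intro divide_right_mono) auto
qed

text \<open>
  If the \<open>k\<close>-th numerator vanishes, the series is a fraction with denominator \<open>scale k\<close> up to an
  error of order \<open>scale k / scale (Suc k)\<close>, because stage \<open>k\<close> was skipped.
\<close>
lemma series_val_liouville_like:
  assumes W: "lacunary M W" and zero: "\<exists>\<^sub>\<infinity>k. W k = 0" and D: "D > 0"
  shows "liouville_like (series_val W / real D)"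
  unfolding liouville_like_def
proof
  fix n
  obtain B :: nat where B: "real B > max (2 * M) (\<bar>series_val W\<bar> + 1)"
    using reals_Archimedean2 by blast
  obtain k where k: "k \<ge> 2 * n + D + B" "W k = 0"
    using zero unfolding INFM_nat_le by blast
  obtain p :: int and t where "series_val W = p / scale k + W k / scale (Suc k) + t"
    and t: "\<bar>t\<bar> \<le> 2 * M * gauge (Suc k)"
    using series_val_split[OF W] by blast
  then have p: "series_val W = p / scale k + t" using k(2) by simp
  define S where "S = real (scale k)"
  have S: "S \<ge> real k" "S \<ge> 1"
    using le_scale[of k] by (auto simp: S_def Suc_le_eq)
  have SD: "S \<ge> real D" "S \<ge> 2 * M" "S \<ge> \<bar>series_val W\<bar> + 1"
    using S k B by linarith+
  define q where "q = D * scale k"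
  have q: "real q = real D * S" by (simp add: q_def S_def)
  have D1: "real D \<ge> 1" using D by simp
  have qS: "real q \<ge> S" using D1 S by (simp add: q mult_le_cancel_right1)
  have M: "M \<ge> 0" by (rule lacunary_nonneg[OF W])
  have err: "\<bar>t\<bar> \<le> 1 / real q ^ n"
  proof -
    have "real q \<le> S * S" unfolding q using SD S by (intro mult_right_mono) auto
    then have "real q ^ n \<le> (S ^ 2) ^ n"
      by (intro power_mono) (auto simp: power2_eq_square)
    also have "\<dots> = S ^ (2 * n)" by (simp add: power_mult)
    finally have "2 * M * real q ^ n \<le> S * S ^ (2 * n)"
      using SD M S by (intro mult_mono) auto
    also have "\<dots> = S ^ (2 * n + 1)" by simp
    also have "\<dots> \<le> S ^ (k + 3)"
      using S k by (intro power_increasing) auto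
    finally have *: "2 * M * real q ^ n \<le> S ^ (k + 3)" .
    have "\<bar>t\<bar> \<le> 2 * M * (scale k / scale (Suc k))"
      by (rule order_trans[OF t]) (use M gauge_Suc_le in \<open>intro mult_left_mono, auto\<close>)
    also have "\<dots> = 2 * M / S ^ (k + 3)"
      by (simp add: scale_Suc ratio_def S_def)
    also have "\<dots> \<le> 1 / real q ^ n"
      using * S qS by (simp add: field_simps)
    finally show ?thesis .
  qed
  have eq: "series_val W / real D - p / real q = t / D"
    using D by (simp add: p q S_def field_simps)
  have "\<bar>t / D\<bar> \<le> \<bar>t\<bar>"
    using D1 by (simp add: divide_le_eq mult_le_cancel_left1)
  with eq err have "\<bar>series_val W / real D - p / real q\<bar> \<le> 1 / real q ^ n" by simp
  moreover have "\<bar>p\<bar> \<le> int q ^ 2"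
  proof -
    have "\<bar>t\<bar> \<le> 1"
      by (rule order_trans[OF err]) (use S qS in \<open>auto intro!: one_le_power\<close>)
    then have "\<bar>p / S\<bar> \<le> S"
      using p SD(3) unfolding S_def by linarith
    then have "\<bar>real_of_int p\<bar> \<le> S * S"
      using S by (simp add: field_simps)
    also have "\<dots> \<le> real q * real q"
      using S qS by (intro mult_mono) auto
    finally have "real_of_int \<bar>p\<bar> \<le> real_of_int (int q ^ 2)"
      by (simp add: power2_eq_square)
    then show ?thesis by (simp only: of_int_le_iff)
  qed
  moreover have "q \<ge> n"
    using S(1) qS k(1) by linarith
  ultimately show "\<exists>q\<ge>n. \<exists>p::int. \<bar>p\<bar> \<le> int q ^ 2 \<and> \<bar>series_val W / real D - p / real q\<bar> \<le> 1 / real q ^ n"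
    by blast
qed

text \<open>
  At a stage \<open>k\<close> with numerator of order \<open>16 ^ k\<close>, this term dominates the tail, which is of order
  \<open>8 ^ k / scale (Suc k)\<close>, yet it is far smaller than \<open>1 / scale k\<close>. The partial sum before it is a
  multiple of \<open>1 / scale k\<close>, so it cannot cancel the term.
\<close>
lemma series_val_nonzero:
  assumes W: "lacunary M W" and \<kappa>: "\<kappa> > 0"
    and big: "\<exists>\<^sub>\<infinity>k. \<kappa> * 16 ^ k \<le> \<bar>real_of_int (W k)\<bar> \<and> \<bar>real_of_int (W k)\<bar> \<le> M * 16 ^ k"
  shows "series_val W \<noteq> 0"
proof
  assume 0: "series_val W = 0"
  obtain B :: nat where B: "real B > max (128 * M / \<kappa>) (129 * M)"
    using reals_Archimedean2 by blast
  obtain k where k: "k \<ge> B" "\<kappa> * 16 ^ k \<le> \<bar>real_of_int (W k)\<bar>" "\<bar>real_of_int (W k)\<bar> \<le> M * 16 ^ k"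
    using big unfolding INFM_nat_le by blast
  have M: "M \<ge> 0" by (rule lacunary_nonneg[OF W])
  obtain p :: int and t where t: "\<bar>t\<bar> \<le> 2 * M * gauge (Suc k)"
    "p / scale k + W k / scale (Suc k) + t = 0"
    using series_val_split[OF W, of k] 0 by metis
  have rpos: "ratio k > 0" by (simp add: ratio_def)
  have k2: "real k < 2 ^ k"
    by (rule of_nat_less_two_power)
  have "p * real (ratio k) + W k + t * scale (Suc k) = 0"
    using t(2) rpos scale_pos[of k, THEN less_imp_neq] by (simp add: scale_Suc field_simps)
  moreover have "\<bar>t * scale (Suc k)\<bar> \<le> 128 * M * 8 ^ k"
  proof -
    have "\<bar>t * scale (Suc k)\<bar> \<le> 2 * M * gauge (Suc k) * scale (Suc k)"
      using t(1) by (simp add: abs_mult mult_right_mono)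
    also have "\<dots> = 128 * M * 8 ^ k"
      by (simp add: gauge_def)
    finally show ?thesis .
  qed
  ultimately have *: "\<bar>p * real (ratio k) + W k\<bar> \<le> 128 * M * 8 ^ k"
    by linarith
  have e16: "(16::real) ^ k = 2 ^ k * 8 ^ k"
    by (simp flip: power_mult_distrib)
  have "128 * M < \<kappa> * 2 ^ k"
  proof -
    have "128 * M / \<kappa> < 2 ^ k" using B k(1) k2 by linarith
    then show ?thesis using \<kappa> by (simp add: field_simps)
  qed
  then have "128 * M * 8 ^ k < \<kappa> * 16 ^ k"
    unfolding e16 by simp
  with * k(2) have "p \<noteq> 0" by auto
  then have "1 \<le> \<bar>real_of_int p\<bar>" by (metis of_int_1_le_iff of_int_abs zero_less_abs_iff int_one_le_iff_zero_less)
  then have "real (ratio k) \<le> \<bar>p * real (ratio k)\<bar>"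
    by (simp add: abs_mult mult_le_cancel_right1)
  also have "\<dots> \<le> M * 16 ^ k + 128 * M * 8 ^ k"
    using * k(3) by linarith
  also have "\<dots> \<le> M * 16 ^ k + 128 * M * 16 ^ k"
    using M by (intro add_left_mono mult_left_mono power_mono) auto
  also have "\<dots> = 129 * M * 16 ^ k" by simp
  also have "\<dots> < 2 ^ k * 16 ^ k"
    using B k(1) k2 by (intro mult_strict_right_mono) (linarith | simp)+
  also have "\<dots> \<le> 64 ^ (k + 2)"
  proof -
    have "(2::real) ^ k * 16 ^ k = 32 ^ k" by (simp flip: power_mult_distrib)
    also have "\<dots> \<le> 64 ^ k" by (intro power_mono) auto
    also have "\<dots> \<le> 64 ^ (k + 2)" by (intro power_increasing) auto
    finally show ?thesis .
  qed
  also have "\<dots> \<le> real (ratio k)"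
  proof -
    have "real (64 ^ (k + 2)) \<le> real (ratio k)" using ratio_ge(2) by (simp only: of_nat_le_iff)
    then show ?thesis by simp
  qed
  finally show False by simp
qed

section \<open>An independent family of tasks\<close>
text \<open>
  The number \<open>k\<close> encodes, with infinite repetition, a finite table indexed by finite prefixes;
  the table is consulted with a prefix of the sequence \<open>z\<close>. This is the usual construction of an
  independent family of continuum many functions. The cut-off \<open>min N k\<close> makes the value depend on
  the first \<open>k\<close> entries only, which allows entry \<open>k\<close> of a code to be chosen after its task is known.
\<close>
definition task :: "nat \<Rightarrow> (nat \<Rightarrow> 'a::countable) \<Rightarrow> 'g::countable option" where
  "task k z = (case from_nat (fst (prod_decode k)) of (N :: nat, L) \<Rightarrow> map_of L (map z [0..<min N k]))"

lemma task_cong: "(\<And>j. j < k \<Longrightarrow> z j = z' j) \<Longrightarrow> task k z = task k z'"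
proof -
  assume "\<And>j. j < k \<Longrightarrow> z j = z' j"
  then have *: "map z [0..<min N k] = map z' [0..<min N k]" for N by simp
  show ?thesis by (simp only: task_def *)
qed

lemma prefixes_separate:
  fixes I :: "(nat \<Rightarrow> 'a) set"
  assumes "finite I"
  obtains N where "inj_on (\<lambda>z. map z [0..<N]) I"
proof -
  define d where "d = (\<lambda>(z :: nat \<Rightarrow> 'a, z'). LEAST j. z j \<noteq> z' j)"
  define N where "N = Suc (Max (insert 0 (d ` (I \<times> I))))"
  have "z = z'" if "z \<in> I" "z' \<in> I" "map z [0..<N] = map z' [0..<N]" for z z'
  proof (rule ccontr)
    assume "z \<noteq> z'"
    then obtain j where "z j \<noteq> z' j" by auto
    then have "z (d (z, z')) \<noteq> z' (d (z, z'))"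
      unfolding d_def by (simp add: LeastI[of "\<lambda>j. z j \<noteq> z' j"])
    moreover have "d (z, z') < N"
      unfolding N_def using assms that by (intro le_imp_less_Suc Max_ge) auto
    moreover have "map z [0..<N] ! d (z, z') = map z' [0..<N] ! d (z, z')"
      by (simp only: that(3))
    ultimately show False by simp
  qed
  then show ?thesis by (intro that[of N] inj_onI)
qed

lemma finite_map_of:
  assumes "finite W"
  shows "\<exists>L. dom (map_of L) = W \<and> (\<forall>w\<in>W. map_of L w = Some (f w))"
proof -
  obtain ws where "set ws = W" using finite_list[OF assms] by blast
  then have "map_of (map (\<lambda>w. (w, f w)) ws) w = (if w \<in> W then Some (f w) else None)" for w
    by (simp add: map_of_map_restrict restrict_map_def)
  then show ?thesis
    by (intro exI[of _ "map (\<lambda>w. (w, f w)) ws"]) (auto simp: dom_def split: if_splits)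
qed

text \<open>
  A prefix length that separates the members of \<open>I\<close> turns any assignment on \<open>I\<close> into a finite
  table, and each table is encoded by infinitely many \<open>k\<close>.
\<close>
lemma task_realises:
  fixes g :: "(nat \<Rightarrow> 'a::countable) \<Rightarrow> 'g::countable"
  assumes "finite I"
  shows "\<exists>\<^sub>\<infinity>k. \<forall>z\<in>I. task k z = Some (g z)"
  unfolding INFM_nat_le
proof
  fix m
  obtain N where inj: "inj_on (\<lambda>z. map z [0..<N]) I"
    using prefixes_separate[OF assms] .
  define pre where "pre z = map z [0..<N]" for z :: "nat \<Rightarrow> 'a"
  obtain L where L: "\<forall>w\<in>pre ` I. map_of L w = Some (g (inv_into I pre w))"
    using finite_map_of[OF finite_imageI[OF assms, of pre], of "\<lambda>w. g (inv_into I pre w)"] by blast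
  define k where "k = prod_encode (to_nat (N, L), m + N)"
  have k: "m + N \<le> k" unfolding k_def by (rule le_prod_encode_2)
  have "task k z = Some (g z)" if "z \<in> I" for z
  proof -
    have "task k z = map_of L (pre z)"
      using k by (simp add: task_def k_def pre_def min_absorb1 del: add_leE)
    also have "\<dots> = Some (g z)"
      using that L inv_into_f_f[of pre I z] inj by (simp add: pre_def[abs_def])
    finally show ?thesis .
  qed
  then show "\<exists>k\<ge>m. \<forall>z\<in>I. task k z = Some (g z)"
    using k by (intro exI[of _ k]) auto
qed

section \<open>Codes and their numbers\<close>
text \<open>
  Entry \<open>k\<close> of a code consists of a digit of the slope and of the free coefficient of stage \<open>k\<close>.
\<close>
type_synonym code = "nat \<Rightarrow> int \<times> int"

definition Codes :: "code set" where
  "Codes = {z. \<forall>k. fst (z k) \<in> {0..15} \<and> \<bar>snd (z k)\<bar> \<le> 4 ^ (k + 1) * int (ratio k)}"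

text \<open>
  The numerator of the truncation \<open>num z k / 16 ^ k\<close> of the slope.
\<close>
primrec num :: "code \<Rightarrow> nat \<Rightarrow> int" where
  "num z 0 = 0"
| "num z (Suc k) = 16 * num z k + fst (z k)"

definition slope :: "code \<Rightarrow> real" where
  "slope z = (\<Sum>k. real_of_int (fst (z k)) / 16 ^ Suc k)"

text \<open>
  The guard refers to the truncated slope, so that it depends on a prefix only; the summand \<open>\<bar>v\<bar>\<close> pays for the
  truncation. A direction that passes satisfies \<open>\<bar>u + v * slope z\<bar> \<ge> 1 / 2 ^ k\<close>, and the default
  \<open>(1, 0)\<close> does so trivially.
\<close>
definition direction :: "nat \<Rightarrow> code \<Rightarrow> int \<times> int" where
  "direction k z = (case task k z of
     Some (u, v, e :: bool) \<Rightarrow>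
       if \<bar>u\<bar> \<le> 2 ^ k \<and> \<bar>v\<bar> \<le> 2 ^ k \<and> 8 ^ k + \<bar>v\<bar> \<le> \<bar>16 ^ k * u + v * num z k\<bar> then (u, v) else (1, 0)
   | None \<Rightarrow> (1, 0))"

definition marked :: "nat \<Rightarrow> code \<Rightarrow> bool" where
  "marked k z = (case task k z of Some (u :: int, v :: int, e) \<Rightarrow> e | None \<Rightarrow> False)"

text \<open>
  The numerators of stage \<open>k\<close>: the vector \<open>(first_coeff k z, second_coeff k z)\<close> is the free coefficient
  times the direction, plus the vector \<open>16 ^ k * (-\<xi>\<^sub>k, 1)\<close> if the stage is marked, where \<open>\<xi>\<^sub>k\<close> is the
  truncated slope. The marking vector changes \<open>a + \<xi> b\<close> by at most one unit for \<open>\<xi>\<close> the slope,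
  but is of order \<open>16 ^ k\<close> in every rational form \<open>r a + s b\<close> that is not proportional to this one.
\<close>
definition first_coeff :: "nat \<Rightarrow> code \<Rightarrow> int" where
  "first_coeff k z = fst (direction k z) * snd (z k) - (if marked k z then num z k else 0)"

definition second_coeff :: "nat \<Rightarrow> code \<Rightarrow> int" where
  "second_coeff k z = snd (direction k z) * snd (z k) + (if marked k z then 16 ^ k else 0)"

definition first_num :: "code \<Rightarrow> real" where "first_num z = series_val (\<lambda>k. first_coeff k z)"
definition second_num :: "code \<Rightarrow> real" where "second_num z = series_val (\<lambda>k. second_coeff k z)"

lemma num_bounds: "z \<in> Codes \<Longrightarrow> 0 \<le> num z k \<and> num z k < 16 ^ k"
proof (induction k)
  case (Suc k)
  have "fst (z k) \<in> {0..15}" using Suc.prems by (simp add: Codes_def)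
  with Suc show ?case by auto
qed simp

lemma slope_approx:
  assumes z: "z \<in> Codes"
  shows "num z k / 16 ^ k \<le> slope z" "slope z \<le> num z k / 16 ^ k + 1 / 16 ^ k"
proof -
  have d: "0 \<le> real_of_int (fst (z j))" "real_of_int (fst (z j)) \<le> 15" for j
    using z by (auto simp: Codes_def)
  have g: "(\<lambda>j. 15 / 16 ^ Suc k * (1 / 16 :: real) ^ j) sums (15 / 16 ^ Suc k * (1 / (1 - 1 / 16)))"
    by (intro sums_mult geometric_sums) simp
  have le: "fst (z (j + k)) / 16 ^ Suc (j + k) \<le> 15 / 16 ^ Suc k * (1 / 16 :: real) ^ j" for j
    using d(2)[of "j + k"] by (simp add: power_add power_divide field_simps)
  have sk: "summable (\<lambda>j. fst (z (j + k)) / 16 ^ Suc (j + k) :: real)"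
    by (rule summable_comparison_test'[OF sums_summable[OF g], of 0]) (use le d(1) in simp)
  then have s: "summable (\<lambda>j. fst (z j) / 16 ^ Suc j :: real)"
    by (rule summable_iff_shift[THEN iffD1])
  have part: "(\<Sum>j<i. fst (z j) / 16 ^ Suc j :: real) = num z i / 16 ^ i" for i
    by (induction i) (simp_all add: field_simps)
  have split: "slope z = (\<Sum>j. fst (z (j + k)) / 16 ^ Suc (j + k)) + num z k / 16 ^ k"
    unfolding slope_def using suminf_split_initial_segment[OF s, of k] part by simp
  have "0 \<le> (\<Sum>j. fst (z (j + k)) / 16 ^ Suc (j + k) :: real)"
    by (rule suminf_nonneg[OF sk]) (rule divide_nonneg_nonneg, use d(1) in auto)
  moreover have "(\<Sum>j. fst (z (j + k)) / 16 ^ Suc (j + k) :: real) \<le> 1 / 16 ^ k"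
    using suminf_le[OF le sk sums_summable[OF g]] sums_unique[OF g] by simp
  ultimately show "num z k / 16 ^ k \<le> slope z" "slope z \<le> num z k / 16 ^ k + 1 / 16 ^ k"
    unfolding split by auto
qed

lemma abs_scaled: "16 ^ k * \<bar>u + v * (n / 16 ^ k)\<bar> = \<bar>16 ^ k * u + v * n\<bar>" for u v n :: real
proof -
  have "16 ^ k * \<bar>u + v * (n / 16 ^ k)\<bar> = \<bar>16 ^ k * (u + v * (n / 16 ^ k))\<bar>"
    by (simp add: abs_mult)
  also have "16 ^ k * (u + v * (n / 16 ^ k)) = 16 ^ k * u + v * n"
    by (simp add: field_simps)
  finally show ?thesis .
qed

lemma linear_form_approx:
  fixes u v :: real
  assumes "z \<in> Codes"
  shows "\<bar>(u + v * slope z) - (u + v * (num z k / 16 ^ k))\<bar> \<le> \<bar>v\<bar> / 16 ^ k"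
proof -
  have "\<bar>slope z - num z k / 16 ^ k\<bar> \<le> 1 / 16 ^ k"
    using slope_approx[OF assms, of k] by linarith
  then have "\<bar>v * (slope z - num z k / 16 ^ k)\<bar> \<le> \<bar>v\<bar> * (1 / 16 ^ k)"
    unfolding abs_mult by (intro mult_left_mono) auto
  then show ?thesis by (simp add: algebra_simps)
qed

lemma direction_bounds:
  assumes z: "z \<in> Codes" and d: "direction k z = (u, v)"
  shows "\<bar>u\<bar> \<le> 2 ^ k" "\<bar>v\<bar> \<le> 2 ^ k" "1 / 2 ^ k \<le> \<bar>u + v * slope z\<bar>"
proof -
  have *: "\<bar>u\<bar> \<le> 2 ^ k \<and> \<bar>v\<bar> \<le> 2 ^ k \<and> 8 ^ k + \<bar>v\<bar> \<le> \<bar>16 ^ k * u + v * num z k\<bar>"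
    using d by (auto simp: direction_def power_mono split: option.splits prod.splits if_splits)
  then show "\<bar>u\<bar> \<le> 2 ^ k" "\<bar>v\<bar> \<le> 2 ^ k" by auto
  define Y where "Y = u + v * (num z k / 16 ^ k)"
  have "real_of_int (8 ^ k + \<bar>v\<bar>) \<le> real_of_int \<bar>16 ^ k * u + v * num z k\<bar>"
    using * by (simp only: of_int_le_iff)
  then have "8 ^ k + \<bar>real_of_int v\<bar> \<le> 16 ^ k * \<bar>Y\<bar>"
    unfolding Y_def abs_scaled by simp
  then have "(8 ^ k + \<bar>real_of_int v\<bar>) / 16 ^ k \<le> \<bar>Y\<bar>"
    by (simp add: field_simps)
  moreover have "(8 ^ k :: real) / 16 ^ k = 1 / 2 ^ k"
    by (simp flip: power_divide add: power_one_over)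
  ultimately have "1 / 2 ^ k + \<bar>real_of_int v\<bar> / 16 ^ k \<le> \<bar>Y\<bar>"
    by (simp add: add_divide_distrib)
  then show "1 / 2 ^ k \<le> \<bar>u + v * slope z\<bar>"
    using linear_form_approx[OF z, of u v k, folded Y_def] by linarith
qed

lemma coeffs_bounds:
  assumes z: "z \<in> Codes"
  shows "\<bar>first_coeff k z\<bar> \<le> 8 ^ (k + 1) * int (ratio k)" "\<bar>second_coeff k z\<bar> \<le> 8 ^ (k + 1) * int (ratio k)"
proof -
  obtain u v where uv: "direction k z = (u, v)" by fastforce
  have t: "\<bar>snd (z k)\<bar> \<le> 4 ^ (k + 1) * int (ratio k)" using z by (simp add: Codes_def)
  have p: "\<bar>w * snd (z k)\<bar> \<le> 4 * 8 ^ k * int (ratio k)" if "\<bar>w\<bar> \<le> 2 ^ k" for w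
  proof -
    have "\<bar>w * snd (z k)\<bar> \<le> 2 ^ k * (4 ^ (k + 1) * int (ratio k))"
      unfolding abs_mult using t that by (intro mult_mono) auto
    also have "\<dots> = 4 * (2 * 4) ^ k * int (ratio k)" by (simp only: power_mult_distrib) simp
    finally show ?thesis by simp
  qed
  have "(2::nat) ^ k \<le> 8 ^ (k + 2)"
    using power_mono[of "2::nat" 8 k] power_increasing[of k "k + 2" "8::nat"] by linarith
  then have "2 ^ k \<le> ratio k" using ratio_ge(1)[of k] by linarith
  then have "(2::int) ^ k \<le> int (ratio k)" by (metis of_nat_le_iff of_nat_numeral of_nat_power)
  then have "8 ^ k * 2 ^ k \<le> (8::int) ^ k * int (ratio k)"
    by (intro mult_left_mono) auto
  then have r: "16 ^ k \<le> (8::int) ^ k * int (ratio k)"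
    by (simp flip: power_mult_distrib)
  show "\<bar>first_coeff k z\<bar> \<le> 8 ^ (k + 1) * int (ratio k)"
    using p[of u] direction_bounds(1)[OF z uv] num_bounds[OF z, of k] r
    by (simp add: first_coeff_def uv split: if_splits) linarith
  show "\<bar>second_coeff k z\<bar> \<le> 8 ^ (k + 1) * int (ratio k)"
  proof -
    have "\<bar>second_coeff k z\<bar> \<le> \<bar>v * snd (z k)\<bar> + 16 ^ k"
      using abs_triangle_ineq[of "v * snd (z k)" "16 ^ k"] by (simp add: second_coeff_def uv)
    also have "\<dots> \<le> 4 * 8 ^ k * int (ratio k) + 8 ^ k * int (ratio k)"
      by (intro add_mono p direction_bounds(2)[OF z uv] r)
    also have "\<dots> \<le> 8 ^ (k + 1) * int (ratio k)" by simp
    finally show ?thesis .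
  qed
qed

text \<open>
  The guard in the definition of the direction rejects a fixed \<open>(u, v)\<close> only finitely often unless the
  form vanishes at the slope. For irrational slopes it thus eventually accepts every nonzero \<open>(u, v)\<close>.
\<close>
lemma direction_eventually:
  assumes z: "z \<in> Codes" and nz: "u + v * slope z \<noteq> 0"
  shows "\<forall>\<^sub>F k in sequentially. \<forall>e :: bool. task k z = Some (u, v, e) \<longrightarrow> direction k z = (u, v)"
proof -
  define c where "c = \<bar>u + v * slope z\<bar>"
  have c: "c > 0" using nz by (simp add: c_def)
  obtain B :: nat where B: "real B > max (max (real_of_int \<bar>u\<bar>) (real_of_int \<bar>v\<bar>)) ((1 + 2 * \<bar>v\<bar>) / c)"
    using reals_Archimedean2 by blast
  have "direction k z = (u, v)" if k: "k \<ge> B" and t: "task k z = Some (u, v, e)"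
    for k and e :: bool
  proof -
    have k2: "real k < 2 ^ k" by (rule of_nat_less_two_power)
    have kB: "real B \<le> real k" using k by simp
    have "real_of_int \<bar>u\<bar> < real B" "real_of_int \<bar>v\<bar> < real B"
      using B by auto
    then have "real_of_int \<bar>u\<bar> \<le> real_of_int (2 ^ k)" "real_of_int \<bar>v\<bar> \<le> real_of_int (2 ^ k)"
      using kB k2 unfolding of_int_power of_int_numeral by linarith+
    then have uv: "\<bar>u\<bar> \<le> 2 ^ k" "\<bar>v\<bar> \<le> 2 ^ k"
      by (simp_all only: of_int_le_iff)
    define Y where "Y = u + v * (num z k / 16 ^ k)"
    have "c \<le> \<bar>Y\<bar> + \<bar>real_of_int v\<bar> / 16 ^ k"
      using linear_form_approx[OF z, of u v k, folded Y_def] unfolding c_def by linarith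
    then have "c * 16 ^ k \<le> 16 ^ k * \<bar>Y\<bar> + \<bar>real_of_int v\<bar>"
      by (simp add: field_simps)
    then have 1: "c * 16 ^ k - \<bar>real_of_int v\<bar> \<le> \<bar>16 ^ k * real_of_int u + real_of_int v * num z k\<bar>"
      unfolding Y_def abs_scaled by linarith
    have "(1 + 2 * \<bar>real_of_int v\<bar>) / c < real B" using B by simp
    then have "(1 + 2 * \<bar>real_of_int v\<bar>) / c < 2 ^ k" using kB k2 by linarith
    then have "1 + 2 * \<bar>real_of_int v\<bar> \<le> c * 2 ^ k" using c by (simp add: field_simps)
    then have "8 ^ k * (1 + 2 * \<bar>real_of_int v\<bar>) \<le> 8 ^ k * (c * 2 ^ k)"
      by (intro mult_left_mono) auto
    also have "\<dots> = c * (8 * 2) ^ k" by (simp only: power_mult_distrib mult_ac)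
    finally have 2: "8 ^ k + 2 * (8 ^ k * \<bar>real_of_int v\<bar>) \<le> c * 16 ^ k" by (simp add: distrib_left)
    have "1 * \<bar>real_of_int v\<bar> \<le> 8 ^ k * \<bar>real_of_int v\<bar>"
      by (intro mult_right_mono one_le_power) auto
    with 1 2 have "8 ^ k + \<bar>real_of_int v\<bar> \<le> \<bar>16 ^ k * real_of_int u + real_of_int v * num z k\<bar>"
      by linarith
    then have "real_of_int (8 ^ k + \<bar>v\<bar>) \<le> real_of_int \<bar>16 ^ k * u + v * num z k\<bar>"
      by simp
    then have "8 ^ k + \<bar>v\<bar> \<le> \<bar>16 ^ k * u + v * num z k\<bar>"
      by (simp only: of_int_le_iff)
    with uv t show ?thesis by (simp add: direction_def)
  qed
  then show ?thesis unfolding eventually_sequentially by blast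
qed

section \<open>Combinations of code numbers\<close>
definition comb :: "code set \<Rightarrow> (code \<Rightarrow> int) \<Rightarrow> (code \<Rightarrow> int) \<Rightarrow> real" where
  "comb I r s = (\<Sum>z\<in>I. r z * first_num z + s z * second_num z)"

definition weight :: "code set \<Rightarrow> (code \<Rightarrow> int) \<Rightarrow> (code \<Rightarrow> int) \<Rightarrow> nat \<Rightarrow> int" where
  "weight I r s k = (\<Sum>z\<in>I. r z * first_coeff k z + s z * second_coeff k z)"

definition mass :: "code set \<Rightarrow> (code \<Rightarrow> int) \<Rightarrow> (code \<Rightarrow> int) \<Rightarrow> real" where
  "mass I r s = (\<Sum>z\<in>I. real_of_int (\<bar>r z\<bar> + \<bar>s z\<bar>))"

lemma lacunary_coeffs:
  assumes "z \<in> Codes"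
  shows "lacunary 1 (\<lambda>k. first_coeff k z)" "lacunary 1 (\<lambda>k. second_coeff k z)"
proof -
  have "real_of_int \<bar>w\<bar> \<le> 8 ^ (k + 1) * real (ratio k)" if "\<bar>w\<bar> \<le> 8 ^ (k + 1) * int (ratio k)" for w k
  proof -
    have "real_of_int \<bar>w\<bar> \<le> real_of_int (8 ^ (k + 1) * int (ratio k))"
      using that by (simp only: of_int_le_iff)
    then show ?thesis by simp
  qed
  then show "lacunary 1 (\<lambda>k. first_coeff k z)" "lacunary 1 (\<lambda>k. second_coeff k z)"
    using coeffs_bounds[OF assms] by (auto simp: lacunary_def)
qed

lemma comb_eq_series_val:
  assumes "I \<subseteq> Codes" "finite I"
  shows "comb I r s = series_val (weight I r s)" "lacunary (mass I r s) (weight I r s)"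
proof -
  have S: "summable (\<lambda>k. first_coeff k z / scale (Suc k))" "summable (\<lambda>k. second_coeff k z / scale (Suc k))" if "z \<in> I" for z
    using that assms lacunary_summable lacunary_coeffs by blast+
  have "(\<lambda>k. \<Sum>z\<in>I. r z * (first_coeff k z / scale (Suc k)) + s z * (second_coeff k z / scale (Suc k))) sums comb I r s"
    unfolding comb_def first_num_def second_num_def series_val_def
    by (intro sums_sum sums_add sums_mult summable_sums S)
  moreover have "(\<Sum>z\<in>I. r z * (first_coeff k z / scale (Suc k)) + s z * (second_coeff k z / scale (Suc k)))
      = weight I r s k / scale (Suc k)" for k
    by (simp add: weight_def sum_divide_distrib add_divide_distrib)
  ultimately show "comb I r s = series_val (weight I r s)"
    unfolding series_val_def by (simp add: sums_unique)
  show "lacunary (mass I r s) (weight I r s)"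
    unfolding lacunary_def
  proof
    fix k
    have "\<bar>real_of_int (weight I r s k)\<bar> \<le> (\<Sum>z\<in>I. \<bar>real_of_int (r z * first_coeff k z + s z * second_coeff k z)\<bar>)"
      unfolding weight_def of_int_sum by (rule sum_abs)
    also have "\<dots> \<le> (\<Sum>z\<in>I. real_of_int (\<bar>r z\<bar> + \<bar>s z\<bar>) * (8 ^ (k + 1) * real (ratio k)))"
    proof (rule sum_mono)
      fix z assume "z \<in> I"
      then have z: "z \<in> Codes" using assms by blast
      have "\<bar>real_of_int (first_coeff k z)\<bar> \<le> 8 ^ (k + 1) * real (ratio k)" "\<bar>real_of_int (second_coeff k z)\<bar> \<le> 8 ^ (k + 1) * real (ratio k)"
        using lacunary_coeffs[OF z] unfolding lacunary_def by simp_all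
      then have "\<bar>real_of_int (r z)\<bar> * \<bar>real_of_int (first_coeff k z)\<bar> \<le> \<bar>real_of_int (r z)\<bar> * (8 ^ (k + 1) * real (ratio k))"
        "\<bar>real_of_int (s z)\<bar> * \<bar>real_of_int (second_coeff k z)\<bar> \<le> \<bar>real_of_int (s z)\<bar> * (8 ^ (k + 1) * real (ratio k))"
        by (intro mult_left_mono; simp)+
      then show "\<bar>real_of_int (r z * first_coeff k z + s z * second_coeff k z)\<bar> \<le> real_of_int (\<bar>r z\<bar> + \<bar>s z\<bar>) * (8 ^ (k + 1) * real (ratio k))"
        unfolding of_int_add of_int_mult of_int_abs distrib_right abs_mult[symmetric] by linarith
    qed
    also have "\<dots> = mass I r s * 8 ^ (k + 1) * real (ratio k)"
      by (simp only: mass_def sum_distrib_right[symmetric] mult.assoc)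
    finally show "\<bar>real_of_int (weight I r s k)\<bar> \<le> mass I r s * 8 ^ (k + 1) * real (ratio k)" .
  qed
qed

text \<open>
  The task \<open>(s, -r)\<close> gives the vector \<open>t * (s, -r)\<close>, on which the form \<open>r a + s b\<close> vanishes
  whatever \<open>t\<close> is. Only the marking terms of the codes selected by \<open>e\<close> survive.
\<close>
lemma weight_frequently:
  assumes I: "finite I" "I \<subseteq> Codes" and good: "\<And>z. z \<in> I \<Longrightarrow> s z \<noteq> r z * slope z"
  shows "\<exists>\<^sub>\<infinity>k. weight I r s k = (\<Sum>z\<in>I. if e z then s z * 16 ^ k - r z * num z k else 0)"
proof -
  have "\<exists>\<^sub>\<infinity>k. \<forall>z\<in>I. task k z = Some (s z, - r z, e z)"
    by (rule task_realises[OF I(1)])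
  moreover have "\<forall>\<^sub>\<infinity>k. \<forall>z\<in>I. \<forall>e :: bool. task k z = Some (s z, - r z, e) \<longrightarrow> direction k z = (s z, - r z)"
    unfolding cofinite_eq_sequentially
  proof (intro eventually_ball_finite ballI I(1) direction_eventually)
    fix z assume "z \<in> I"
    then show "z \<in> Codes" "real_of_int (s z) + real_of_int (- r z) * slope z \<noteq> 0"
      using I good by auto
  qed
  ultimately have "\<exists>\<^sub>\<infinity>k. (\<forall>z\<in>I. task k z = Some (s z, - r z, e z)) \<and>
      (\<forall>z\<in>I. \<forall>e :: bool. task k z = Some (s z, - r z, e) \<longrightarrow> direction k z = (s z, - r z))"
    by (rule INFM_conjI)
  then show ?thesis
  proof (rule INFM_mono)
    fix k assume *: "(\<forall>z\<in>I. task k z = Some (s z, - r z, e z)) \<and>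
      (\<forall>z\<in>I. \<forall>e :: bool. task k z = Some (s z, - r z, e) \<longrightarrow> direction k z = (s z, - r z))"
    show "weight I r s k = (\<Sum>z\<in>I. if e z then s z * 16 ^ k - r z * num z k else 0)"
      unfolding weight_def
    proof (rule sum.cong[OF refl])
      fix z assume "z \<in> I"
      with * have t: "task k z = Some (s z, - r z, e z)" by blast
      have "direction k z = (s z, - r z)"
        using *[THEN conjunct2] \<open>z \<in> I\<close> t by auto
      with t show "r z * first_coeff k z + s z * second_coeff k z = (if e z then s z * 16 ^ k - r z * num z k else 0)"
        by (simp add: first_coeff_def second_coeff_def marked_def algebra_simps)
    qed
  qed
qed

lemma comb_liouville_like:
  assumes I: "finite I" "I \<subseteq> Codes" and good: "\<And>z. z \<in> I \<Longrightarrow> s z \<noteq> r z * slope z" and D: "D > 0"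
  shows "liouville_like (comb I r s / real D)"
proof -
  have "\<exists>\<^sub>\<infinity>k. weight I r s k = 0"
    using weight_frequently[OF I good, where e = "\<lambda>_. False"] by simp
  then show ?thesis
    using series_val_liouville_like[OF comb_eq_series_val(2)[OF I(2,1)] _ D]
    by (simp add: comb_eq_series_val(1)[OF I(2,1)])
qed

text \<open>
  Marking only the code \<open>z0\<close> leaves the single numerator \<open>s * 16 ^ k - r * num z0 k\<close>, which is
  \<open>16 ^ k\<close> times a quantity converging to \<open>s - r * slope z0\<close>.
\<close>
lemma comb_nonzero:
  assumes I: "finite I" "I \<subseteq> Codes" and good: "\<And>z. z \<in> I \<Longrightarrow> s z \<noteq> r z * slope z" and z0: "z0 \<in> I"
  shows "comb I r s \<noteq> 0"
proof -
  define \<kappa> where "\<kappa> = \<bar>s z0 - r z0 * slope z0\<bar> / 2"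
  have \<kappa>: "\<kappa> > 0" using good[OF z0] by (simp add: \<kappa>_def)
  have z: "z0 \<in> Codes" using I z0 by blast
  obtain B :: nat where B: "real B > \<bar>r z0\<bar> / \<kappa>"
    using reals_Archimedean2 by blast
  have "\<forall>\<^sub>\<infinity>k. \<kappa> * 16 ^ k \<le> \<bar>real_of_int (s z0 * 16 ^ k - r z0 * num z0 k)\<bar>"
    unfolding MOST_nat_le
  proof (intro exI[of _ B] allI impI)
    fix k assume k: "B \<le> k"
    have "real k < 2 ^ k" by (rule of_nat_less_two_power)
    then have "real k < 16 ^ k"
      using power_mono[of "2::real" 16 k] by linarith
    then have "\<bar>real_of_int (r z0)\<bar> / \<kappa> < 16 ^ k" using B k by linarith
    then have 1: "\<bar>real_of_int (r z0)\<bar> * (1 / 16 ^ k) \<le> \<kappa>" using \<kappa> by (simp add: field_simps)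
    define Y where "Y = s z0 + (- r z0) * (num z0 k / 16 ^ k)"
    have "\<bar>(s z0 - r z0 * slope z0) - Y\<bar> \<le> \<kappa>"
      using linear_form_approx[OF z, of "s z0" "- r z0" k] 1 unfolding Y_def by simp
    then have "\<kappa> \<le> \<bar>Y\<bar>"
      using abs_triangle_ineq2[of "s z0 - r z0 * slope z0" Y] by (simp add: \<kappa>_def)
    then have "\<kappa> * 16 ^ k \<le> 16 ^ k * \<bar>Y\<bar>" by simp
    also have "\<dots> = \<bar>16 ^ k * real_of_int (s z0) + real_of_int (- r z0) * num z0 k\<bar>"
      unfolding Y_def by (simp only: abs_scaled)
    finally show "\<kappa> * 16 ^ k \<le> \<bar>real_of_int (s z0 * 16 ^ k - r z0 * num z0 k)\<bar>"
      by (simp add: mult.commute)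
  qed
  then have "\<exists>\<^sub>\<infinity>k. weight I r s k = s z0 * 16 ^ k - r z0 * num z0 k \<and>
      \<kappa> * 16 ^ k \<le> \<bar>real_of_int (s z0 * 16 ^ k - r z0 * num z0 k)\<bar>"
    using weight_frequently[OF I good, where e = "\<lambda>z. z = z0"] I z0 by (simp add: INFM_conjI)
  moreover have "\<bar>real_of_int (s z0 * 16 ^ k - r z0 * num z0 k)\<bar> \<le> mass I r s * 16 ^ k" for k
  proof -
    have "\<bar>s z0 * 16 ^ k - r z0 * num z0 k\<bar> \<le> \<bar>s z0 * 16 ^ k\<bar> + \<bar>r z0 * num z0 k\<bar>"
      by (rule abs_triangle_ineq4)
    also have "\<dots> \<le> \<bar>s z0\<bar> * 16 ^ k + \<bar>r z0\<bar> * 16 ^ k"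
      unfolding abs_mult using num_bounds[OF z, of k] by (intro add_mono mult_left_mono) auto
    finally have "\<bar>real_of_int (s z0 * 16 ^ k - r z0 * num z0 k)\<bar> \<le> real_of_int ((\<bar>r z0\<bar> + \<bar>s z0\<bar>) * 16 ^ k)"
      unfolding of_int_abs[symmetric] of_int_le_iff by (simp add: algebra_simps)
    also have "\<dots> = real_of_int (\<bar>r z0\<bar> + \<bar>s z0\<bar>) * 16 ^ k" by simp
    also have "\<dots> \<le> mass I r s * 16 ^ k"
      unfolding mass_def using I z0
      by (intro mult_right_mono member_le_sum[of z0 I "\<lambda>z. real_of_int (\<bar>r z\<bar> + \<bar>s z\<bar>)"]) auto
    finally show ?thesis .
  qed
  ultimately have "\<exists>\<^sub>\<infinity>k. \<kappa> * 16 ^ k \<le> \<bar>real_of_int (weight I r s k)\<bar>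
      \<and> \<bar>real_of_int (weight I r s k)\<bar> \<le> mass I r s * 16 ^ k"
    by (auto elim!: INFM_mono)
  then show ?thesis
    using comb_eq_series_val[OF I(2,1), of r s] series_val_nonzero[OF _ \<kappa>] by metis
qed

section \<open>Representing every small number\<close>
text \<open>
  Dependent choice for requirements on prefixes. The requirement is imposed on whole sequences,
  so that functions of sequences need not be restated for finite lists.
\<close>
lemma causal_choice:
  assumes step: "\<And>k z. \<exists>v. R k (z(k := v))"
    and causal: "\<And>k z z'. (\<And>j. j \<le> k \<Longrightarrow> z j = z' j) \<Longrightarrow> R k z \<Longrightarrow> R k z'"
  shows "\<exists>z. \<forall>k :: nat. R k z"
proof -
  define Z where "Z = rec_nat (\<lambda>_. undefined) (\<lambda>k z. z(k := SOME v. R k (z(k := v))))"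
  have Z: "Z (Suc k) = (Z k)(k := SOME v. R k ((Z k)(k := v)))" for k
    by (simp add: Z_def)
  have R: "R k (Z (Suc k))" for k
    unfolding Z using step by (rule someI_ex)
  have stable: "Z (Suc j + i) j = Z (Suc j) j" for i j
    by (induction i) (simp_all add: Z)
  have "Z (Suc k) j = Z (Suc j) j" if "j \<le> k" for j k
    using stable[of j "k - j"] that by simp
  then have "R k (\<lambda>j. Z (Suc j) j)" for k
    by (rule causal[OF _ R])
  then show ?thesis by blast
qed

lemma num_cong: "(\<And>j. j < k \<Longrightarrow> z j = z' j) \<Longrightarrow> num z k = num z' k"
  by (induction k) simp_all

lemma direction_cong: "(\<And>j. j < k \<Longrightarrow> z j = z' j) \<Longrightarrow> direction k z = direction k z'"
  unfolding direction_def by (simp only: task_cong[of k z z'] num_cong[of k z z'])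

lemma marked_cong: "(\<And>j. j < k \<Longrightarrow> z j = z' j) \<Longrightarrow> marked k z = marked k z'"
  unfolding marked_def by (simp only: task_cong[of k z z'])

lemma coeffs_cong:
  assumes "\<And>j. j \<le> k \<Longrightarrow> z j = z' j"
  shows "first_coeff k z = first_coeff k z'" "second_coeff k z = second_coeff k z'"
  using direction_cong[of k z z'] marked_cong[of k z z'] num_cong[of k z z'] assms
  by (simp_all add: first_coeff_def second_coeff_def)

definition digit :: "real \<Rightarrow> nat \<Rightarrow> int" where
  "digit \<xi> k = \<lfloor>16 ^ Suc k * \<xi>\<rfloor> - 16 * \<lfloor>16 ^ k * \<xi>\<rfloor>"

lemma digit_range: "digit \<xi> k \<in> {0..15}"
proof -
  have "16 * \<lfloor>16 ^ k * \<xi>\<rfloor> \<le> \<lfloor>16 ^ Suc k * \<xi>\<rfloor>"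
    using of_int_floor_le[of "16 ^ k * \<xi>"] by (simp add: le_floor_iff mult.assoc)
  moreover have "16 * y < of_int (16 * (\<lfloor>y\<rfloor> + 1))" for y :: real
  proof -
    have "16 * y < 16 * (of_int \<lfloor>y\<rfloor> + 1)"
      by (rule mult_strict_left_mono[OF real_of_int_floor_add_one_gt]) simp
    then show ?thesis by (simp only: of_int_mult of_int_add of_int_numeral of_int_1)
  qed
  then have "16 ^ Suc k * \<xi> < of_int (16 * (\<lfloor>16 ^ k * \<xi>\<rfloor> + 1))"
    unfolding power_Suc mult.assoc .
  then have "\<lfloor>16 ^ Suc k * \<xi>\<rfloor> < 16 * (\<lfloor>16 ^ k * \<xi>\<rfloor> + 1)"
    by (simp only: floor_less_iff)
  ultimately show ?thesis by (auto simp: digit_def)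
qed

lemma slope_of_digits:
  assumes \<xi>: "0 \<le> \<xi>" "\<xi> < 1" and z: "z \<in> Codes" "\<And>k. fst (z k) = digit \<xi> k"
  shows "slope z = \<xi>"
proof -
  have num: "num z k = \<lfloor>16 ^ k * \<xi>\<rfloor>" for k
  proof (induction k)
    case 0
    have "\<lfloor>\<xi>\<rfloor> = 0" using \<xi> by linarith
    then show ?case by simp
  qed (simp add: z(2) digit_def)
  have bound: "\<bar>slope z - \<xi>\<bar> \<le> 2 * (1 / 16) ^ k" for k
  proof -
    have "\<bar>16 ^ k * \<xi> - num z k\<bar> \<le> 1"
      using floor_correct[of "16 ^ k * \<xi>"] unfolding num by linarith
    then have "\<bar>16 ^ k * \<xi> - num z k\<bar> / 16 ^ k \<le> 1 / 16 ^ k"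
      by (intro divide_right_mono) auto
    moreover have "\<bar>16 ^ k * \<xi> - num z k\<bar> / 16 ^ k = \<bar>\<xi> - num z k / 16 ^ k\<bar>"
    proof -
      have "\<xi> - num z k / 16 ^ k = (16 ^ k * \<xi> - num z k) / 16 ^ k"
        by (simp add: diff_divide_distrib)
      then show ?thesis by (simp only: abs_divide) simp
    qed
    ultimately have "\<bar>\<xi> - num z k / 16 ^ k\<bar> \<le> 1 / 16 ^ k" by simp
    then have "\<bar>slope z - \<xi>\<bar> \<le> 2 * (1 / 16 ^ k)"
      using slope_approx[OF z(1), of k] by linarith
    then show ?thesis by (simp add: power_one_over)
  qed
  have "(\<lambda>k. 2 * (1 / 16 :: real) ^ k) \<longlonglongrightarrow> 2 * 0"
    by (intro tendsto_mult tendsto_const LIMSEQ_realpow_zero) auto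
  then have "\<bar>slope z - \<xi>\<bar> \<le> 2 * 0"
    by (rule LIMSEQ_le_const) (use bound in blast)
  then show ?thesis by simp
qed

text \<open>
  Here \<open>\<rho>\<close> is the part of the target not yet reached, \<open>c\<close> the value of the form on the
  direction, and \<open>e\<close> the contribution of the marking term. The coefficient is \<open>\<rho> / c\<close> rounded in units of
  \<open>1 / scale (Suc k)\<close>; the lower bound on \<open>c\<close> keeps it within the range of a code, the
  upper bound keeps the rounding error small.
\<close>
lemma greedy_step:
  fixes c \<rho> :: real and k :: nat
  assumes c: "1 / 2 ^ k \<le> \<bar>c\<bar>" "\<bar>c\<bar> \<le> 2 * 2 ^ k" and \<rho>: "\<bar>\<rho>\<bar> \<le> 2 ^ k / scale k" and e: "\<bar>e\<bar> \<le> 1"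
  obtains t :: int where "\<bar>t\<bar> \<le> 4 ^ (k + 1) * int (ratio k)"
    "\<bar>\<rho> - (c * t + e) / scale (Suc k)\<bar> \<le> 2 ^ Suc k / scale (Suc k)"
proof -
  define S where "S = real (scale (Suc k))"
  have S: "S > 0" by (simp add: S_def)
  have c0: "\<bar>c\<bar> > 0" using c(1) by (smt (verit) zero_less_divide_1_iff zero_less_power)
  define y where "y = \<rho> * S / c"
  define t where "t = round y"
  have ty: "\<bar>of_int t - y\<bar> \<le> 1 / 2"
    unfolding t_def by (rule of_int_round_abs_le)
  have "\<bar>y\<bar> = \<bar>\<rho>\<bar> * S / \<bar>c\<bar>" using S by (simp add: y_def abs_mult)
  also have "\<dots> \<le> (2 ^ k / scale k * S) / (1 / 2 ^ k)"
    using c \<rho> S c0 by (intro frac_le mult_right_mono) auto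
  also have "\<dots> = (2 * 2) ^ k * ratio k"
    unfolding power_mult_distrib by (simp add: S_def scale_Suc)
  finally have y: "\<bar>y\<bar> \<le> 4 ^ k * real (ratio k)" by simp
  have "1 \<le> ratio k" by (simp add: ratio_def Suc_le_eq)
  then have r: "1 * 1 \<le> 4 ^ k * real (ratio k)"
    by (intro mult_mono) auto
  have "\<bar>real_of_int t\<bar> \<le> 4 ^ k * real (ratio k) + 1"
    using y ty by linarith
  also have "\<dots> \<le> 4 * (4 ^ k * real (ratio k))"
    using r by linarith
  also have "\<dots> = real_of_int (4 ^ (k + 1) * int (ratio k))" by simp
  finally have "\<bar>t\<bar> \<le> 4 ^ (k + 1) * int (ratio k)"
    by (simp only: of_int_abs[symmetric] of_int_le_iff)
  moreover have "\<bar>\<rho> - (c * t + e) / S\<bar> \<le> 2 ^ Suc k / S"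
  proof -
    have "\<rho> - (c * t + e) / S = (c * (y - t) - e) / S"
      using c0 S by (simp add: y_def field_simps)
    moreover have "\<bar>c * (y - t)\<bar> \<le> (2 * 2 ^ k) * (1 / 2)"
      unfolding abs_mult using c ty by (intro mult_mono) (auto simp: abs_minus_commute)
    then have "\<bar>c * (y - t) - e\<bar> \<le> 2 ^ k + 1"
      using e by linarith
    then have "\<bar>c * (y - t) - e\<bar> \<le> 2 ^ Suc k"
      using one_le_power[of "2::real" k] unfolding power_Suc by linarith
    ultimately show ?thesis
      using S by (simp add: divide_right_mono)
  qed
  ultimately show ?thesis using that unfolding S_def by blast
qed

text \<open>
  The construction works for rational \<open>\<xi>\<close> as well, and codes of rational slope would therefore
  generate the whole line as a rational space. This is why only irrational slopes are admitted below.
\<close>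
lemma greedy_representation:
  assumes \<xi>: "0 \<le> \<xi>" "\<xi> < 1" and x: "\<bar>x\<bar> \<le> 1 / scale 0"
  shows "\<exists>z\<in>Codes. slope z = \<xi> \<and> first_num z + \<xi> * second_num z = x"
proof -
  define rem where "rem k z = x - (\<Sum>j<k. (first_coeff j z + \<xi> * second_coeff j z) / scale (Suc j))" for k z
  define good where "good k z \<longleftrightarrow> fst (z k) = digit \<xi> k \<and> \<bar>snd (z k)\<bar> \<le> 4 ^ (k + 1) * int (ratio k)"
    for k and z :: code
  define small where "small k z \<longleftrightarrow> \<bar>rem k z\<bar> \<le> 2 ^ k / scale k" for k z
  have rem_cong: "rem k z = rem k z'" if "\<And>j. j < k \<Longrightarrow> z j = z' j" for k z z'
    unfolding rem_def using that coeffs_cong[of _ z z'] by (intro arg_cong2[where f = minus] sum.cong) simp_all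
  define R where "R k z \<longleftrightarrow> (\<forall>j<k. good j z) \<and> small k z \<longrightarrow> good k z \<and> small (Suc k) z" for k z
  have "\<exists>z. \<forall>k. R k z"
  proof (rule causal_choice)
    fix k :: nat and z z' :: code
    assume eq: "\<And>j. j \<le> k \<Longrightarrow> z j = z' j" and "R k z"
    moreover have "rem k z = rem k z'" "rem (Suc k) z = rem (Suc k) z'"
      by (rule rem_cong; use eq in simp)+
    ultimately show "R k z'"
      by (simp add: R_def good_def small_def)
  next
    fix k :: nat and z :: code
    show "\<exists>v. R k (z(k := v))"
    proof (cases "(\<forall>j<k. good j z) \<and> small k z")
      case True
      \<comment> \<open>Completing the prefix to a code gives access to the bounds for the direction.\<close>
      define z' where "z' j = (if j < k then z j else (digit \<xi> j, 0))" for j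
      have g: "good j z'" for j
        using True by (auto simp: z'_def good_def)
      then have z': "z' \<in> Codes"
        using digit_range[of \<xi>] by (simp add: Codes_def good_def)
      have slope: "slope z' = \<xi>"
        using slope_of_digits[OF \<xi> z'] g by (simp add: good_def)
      obtain u v where uv: "direction k z' = (u, v)" by fastforce
      define e where "e = (if marked k z' then 16 ^ k * \<xi> - num z' k else 0)"
      have "0 \<le> \<xi> - num z' k / 16 ^ k" "\<xi> - num z' k / 16 ^ k \<le> 1 / 16 ^ k"
        using slope_approx[OF z', of k] by (auto simp: slope)
      then have "16 ^ k * 0 \<le> 16 ^ k * (\<xi> - num z' k / 16 ^ k)"
        "16 ^ k * (\<xi> - num z' k / 16 ^ k) \<le> 16 ^ k * (1 / 16 ^ k)"
        by (intro mult_left_mono; simp)+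
      then have e: "\<bar>e\<bar> \<le> 1"
        unfolding e_def by (simp add: right_diff_distrib)
      have c: "1 / 2 ^ k \<le> \<bar>u + v * \<xi>\<bar>"
        using direction_bounds(3)[OF z' uv] by (simp add: slope)
      have "\<bar>real_of_int u\<bar> \<le> 2 ^ k" "\<bar>real_of_int v\<bar> \<le> 2 ^ k"
        using direction_bounds(1,2)[OF z' uv]
        by (metis of_int_abs of_int_le_iff of_int_numeral of_int_power)+
      moreover from this(2) have "\<bar>v * \<xi>\<bar> \<le> 2 ^ k * 1"
        unfolding abs_mult using \<xi> by (intro mult_mono) auto
      ultimately have c': "\<bar>u + v * \<xi>\<bar> \<le> 2 * 2 ^ k"
        by linarith
      obtain t :: int where t: "\<bar>t\<bar> \<le> 4 ^ (k + 1) * int (ratio k)"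
        "\<bar>rem k z - ((u + v * \<xi>) * t + e) / scale (Suc k)\<bar> \<le> 2 ^ Suc k / scale (Suc k)"
        using greedy_step[OF c c' _ e] True unfolding small_def by blast
      define w where "w = z(k := (digit \<xi> k, t))"
      have "direction k w = (u, v)" "marked k w = marked k z'" "num w k = num z' k"
        unfolding uv[symmetric]
        by (rule direction_cong marked_cong num_cong; simp add: w_def z'_def)+
      then have "first_coeff k w + \<xi> * second_coeff k w = (u + v * \<xi>) * t + e"
        by (simp add: first_coeff_def second_coeff_def w_def e_def algebra_simps)
      moreover have "rem k w = rem k z"
        by (rule rem_cong) (simp add: w_def)
      ultimately have "rem (Suc k) w = rem k z - ((u + v * \<xi>) * t + e) / scale (Suc k)"
        by (simp add: rem_def)
      then have "small (Suc k) w"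
        using t(2) by (simp add: small_def)
      moreover have "good k w"
        using t(1) by (simp add: good_def w_def)
      ultimately show ?thesis
        unfolding R_def w_def by blast
    next
      case False
      have "rem k (z(k := v)) = rem k z" for v
        by (rule rem_cong) simp
      then have "\<not> ((\<forall>j<k. good j (z(k := v))) \<and> small k (z(k := v)))" for v
        using False by (auto simp: good_def small_def)
      then show ?thesis
        unfolding R_def by blast
    qed
  qed
  then obtain z where R: "\<And>k. R k z" by blast
  have inv: "(\<forall>j<k. good j z) \<and> small k z" for k
  proof (induction k)
    case 0
    show ?case using x by (simp add: small_def rem_def)
  next
    case (Suc k)
    then show ?case using R[of k] by (auto simp: R_def less_Suc_eq)
  qed
  have good: "good k z" for k using inv[of "Suc k"] by blast
  have z: "z \<in> Codes"
    using good digit_range[of \<xi>] by (simp add: Codes_def good_def)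
  have slope: "slope z = \<xi>"
    using slope_of_digits[OF \<xi> z] good by (simp add: good_def)
  have "(\<lambda>j. first_coeff j z / scale (Suc j) + \<xi> * (second_coeff j z / scale (Suc j))) sums (first_num z + \<xi> * second_num z)"
    unfolding first_num_def second_num_def series_val_def
    by (intro sums_add sums_mult summable_sums lacunary_summable[OF lacunary_coeffs(1)[OF z]]
        lacunary_summable[OF lacunary_coeffs(2)[OF z]])
  then have "(\<lambda>k. \<Sum>j<k. (first_coeff j z + \<xi> * second_coeff j z) / scale (Suc j)) \<longlonglongrightarrow> first_num z + \<xi> * second_num z"
    by (simp add: sums_def add_divide_distrib)
  then have "(\<lambda>k. rem k z) \<longlonglongrightarrow> x - (first_num z + \<xi> * second_num z)"
    unfolding rem_def by (intro tendsto_intros)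
  moreover have "(\<lambda>k. rem k z) \<longlonglongrightarrow> 0"
  proof (rule Lim_null_comparison)
    have "norm (rem k z) \<le> (1 / 4) ^ k" for k
    proof -
      have "8 ^ k \<le> scale k"
        using scale_ge[of k] power_increasing[of k "k + 2" "8::nat"] by linarith
      then have "real (8 ^ k) \<le> real (scale k)"
        by (simp only: of_nat_le_iff)
      then have "2 ^ k / real (scale k) \<le> 2 ^ k / 8 ^ k"
        by (intro divide_left_mono) auto
      also have "\<dots> = (1 / 4) ^ k" by (simp flip: power_divide)
      finally show ?thesis using inv[of k] by (simp add: small_def)
    qed
    then show "\<forall>\<^sub>F k in sequentially. norm (rem k z) \<le> (1 / 4) ^ k" by simp
    show "(\<lambda>k. (1 / 4 :: real) ^ k) \<longlonglongrightarrow> 0" by (rule LIMSEQ_realpow_zero) auto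
  qed
  ultimately have "x - (first_num z + \<xi> * second_num z) = 0"
    by (rule LIMSEQ_unique)
  with z slope show ?thesis by (intro bexI[of _ z]) auto
qed

section \<open>Compactness of the code space\<close>
lemma open_cylinder: "open {w :: code. \<forall>j<k. w j = z j}"
proof -
  have "open ((\<lambda>w :: code. w j) -` ({fst (z j)} \<times> {snd (z j)}))" for j
    by (intro open_vimage open_Times open_discrete continuous_on_product_coordinates)
  then have "open (\<Inter>j\<in>{..<k}. (\<lambda>w :: code. w j) -` ({fst (z j)} \<times> {snd (z j)}))"
    by (intro open_INT) auto
  also have "(\<Inter>j\<in>{..<k}. (\<lambda>w :: code. w j) -` ({fst (z j)} \<times> {snd (z j)})) = {w. \<forall>j<k. w j = z j}"
    by (auto simp: prod_eq_iff)
  finally show ?thesis .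
qed

lemma continuous_on_causal:
  fixes g :: "code \<Rightarrow> 'b::topological_space"
  assumes "\<And>z z'. (\<And>j. j < k \<Longrightarrow> z j = z' j) \<Longrightarrow> g z = g z'"
  shows "continuous_on S g"
proof -
  have "open (g -` U)" for U
  proof -
    have eq: "g -` U = (\<Union>z\<in>g -` U. {w. \<forall>j<k. w j = z j})"
    proof (intro equalityI subsetI)
      fix w assume "w \<in> (\<Union>z\<in>g -` U. {w. \<forall>j<k. w j = z j})"
      then obtain z where "g z \<in> U" "\<And>j. j < k \<Longrightarrow> w j = z j" by auto
      then show "w \<in> g -` U" using assms[of w z] by simp
    qed auto
    show ?thesis
      by (subst eq) (intro open_UN ballI open_cylinder)
  qed
  then have "continuous_on UNIV g"
    by (simp add: continuous_on_open_vimage)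
  then show ?thesis
    using continuous_on_subset by blast
qed

lemma compact_Codes: "compact Codes"
proof -
  define S :: "nat \<Rightarrow> (int \<times> int) set"
    where "S k = {0..15} \<times> {- (4 ^ (k + 1) * int (ratio k))..4 ^ (k + 1) * int (ratio k)}" for k
  have "Codes = PiE UNIV S"
    by (auto simp: Codes_def S_def PiE_def Pi_def abs_le_iff mem_Times_iff minus_le_iff)
  moreover have "compactin (product_topology (\<lambda>_. euclidean) UNIV) (PiE UNIV S)"
    by (simp add: compactin_PiE S_def finite_imp_compact)
  ultimately show ?thesis
    by (simp add: euclidean_product_topology)
qed

lemma continuous_on_series:
  fixes f :: "nat \<Rightarrow> code \<Rightarrow> real"
  assumes causal: "\<And>k z z'. (\<And>j. j \<le> k \<Longrightarrow> z j = z' j) \<Longrightarrow> f k z = f k z'"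
    and bound: "\<And>k z. z \<in> S \<Longrightarrow> \<bar>f k z\<bar> \<le> M k" and M: "summable M"
  shows "continuous_on S (\<lambda>z. \<Sum>k. f k z)"
proof (rule uniform_limit_theorem)
  show "uniform_limit S (\<lambda>n z. \<Sum>k<n. f k z) (\<lambda>z. \<Sum>k. f k z) sequentially"
    by (rule Weierstrass_m_test[OF _ M]) (simp add: bound)
  have "continuous_on S (f k)" for k
    by (rule continuous_on_causal[of "Suc k"]) (auto intro!: causal)
  then show "\<forall>\<^sub>F n in sequentially. continuous_on S (\<lambda>z. \<Sum>k<n. f k z)"
    by (intro always_eventually allI continuous_on_sum)
qed simp

lemma continuous_on_numbers:
  shows "continuous_on Codes first_num" "continuous_on Codes second_num" "continuous_on Codes slope"
proof -
  have "summable (\<lambda>k. gauge 0 * (1 / 2) ^ k)"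
    by (intro summable_mult summable_geometric) simp
  then have gauge: "summable gauge"
    by (rule summable_comparison_test'[of _ 0])
       (use gauge_decay[of 0] gauge_pos in \<open>simp add: less_imp_le\<close>)
  show "continuous_on Codes first_num"
    unfolding first_num_def[abs_def] series_val_def
  proof (rule continuous_on_series[OF _ _ gauge])
    fix k and z z' :: code assume "\<And>j. j \<le> k \<Longrightarrow> z j = z' j"
    then show "first_coeff k z / scale (Suc k) = first_coeff k z' / scale (Suc k)"
      by (simp only: coeffs_cong(1)[of k z z'])
  next
    fix k and z :: code assume "z \<in> Codes"
    then show "\<bar>first_coeff k z / scale (Suc k)\<bar> \<le> gauge k"
      using lacunary_term[OF lacunary_coeffs(1), of z k] by simp
  qed
  show "continuous_on Codes second_num"
    unfolding second_num_def[abs_def] series_val_def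
  proof (rule continuous_on_series[OF _ _ gauge])
    fix k and z z' :: code assume "\<And>j. j \<le> k \<Longrightarrow> z j = z' j"
    then show "second_coeff k z / scale (Suc k) = second_coeff k z' / scale (Suc k)"
      by (simp only: coeffs_cong(2)[of k z z'])
  next
    fix k and z :: code assume "z \<in> Codes"
    then show "\<bar>second_coeff k z / scale (Suc k)\<bar> \<le> gauge k"
      using lacunary_term[OF lacunary_coeffs(2), of z k] by simp
  qed
  have "summable (\<lambda>k. 15 / 16 * (1 / 16 :: real) ^ k)"
    by (intro summable_mult summable_geometric) simp
  then show "continuous_on Codes slope"
    unfolding slope_def[abs_def]
    by (rule continuous_on_series[rotated 2])
       (auto simp: Codes_def power_one_over divide_simps intro!: divide_right_mono)
qed

text \<open>
  Describing the sums by choice functions \<open>\<phi>\<close> keeps track of the index from which each summand comes.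
\<close>
lemma compact_sumset:
  fixes K :: "'i \<Rightarrow> real set"
  assumes "finite W" "\<And>w. w \<in> W \<Longrightarrow> compact (K w)"
  shows "compact {\<Sum>w\<in>W. \<phi> w | \<phi>. \<forall>w\<in>W. \<phi> w \<in> K w}"
  using assms
proof (induction W)
  case (insert a W)
  have "{\<Sum>w\<in>insert a W. \<phi> w | \<phi>. \<forall>w\<in>insert a W. \<phi> w \<in> K w}
      = {x + y | x y. x \<in> K a \<and> y \<in> {\<Sum>w\<in>W. \<phi> w | \<phi>. \<forall>w\<in>W. \<phi> w \<in> K w}}" (is "?L = ?R")
  proof
    show "?L \<subseteq> ?R" using insert.hyps by auto
    show "?R \<subseteq> ?L"
    proof clarify
      fix x \<phi> assume "x \<in> K a" "\<forall>w\<in>W. \<phi> w \<in> K w"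
      then show "\<exists>\<phi>'. x + (\<Sum>w\<in>W. \<phi> w) = (\<Sum>w\<in>insert a W. \<phi>' w) \<and> (\<forall>w\<in>insert a W. \<phi>' w \<in> K w)"
        using insert.hyps by (intro exI[of _ "\<phi>(a := x)"]) (auto intro!: sum.cong)
    qed
  qed
  then show ?case
    using insert by (simp add: compact_sums del: mem_Collect_eq)
qed simp


section \<open>Combinations as countable unions of compact sets\<close>
text \<open>
  The condition on \<open>r\<close> and \<open>s\<close> says that the directions \<open>(s, -r)\<close> are eventually accepted. It is
  closed under limits only when quantified by a lower bound on \<open>\<bar>s - r * slope z\<bar>\<close>.
\<close>
definition admissible :: "code set \<Rightarrow> (code \<Rightarrow> int) \<Rightarrow> (code \<Rightarrow> int) \<Rightarrow> bool" where
  "admissible I r s \<longleftrightarrow> finite I \<and> I \<subseteq> Codes \<and> (\<forall>z\<in>I. real_of_int (s z) \<noteq> r z * slope z)"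

definition quotients_meeting :: "code set \<Rightarrow> real set" where
  "quotients_meeting E = {comb I r s / real D | D I r s. D > 0 \<and> admissible I r s \<and> I \<inter> E \<noteq> {}}"

text \<open>
  Two noncompact conditions on a combination, namely distinctness of its codes and admissibility,
  are replaced by countably many closed ones: prescribed distinct prefixes of a
  common length \<open>N\<close>, and a fixed margin \<open>1 / (m + 1)\<close>.
\<close>
definition cell :: "nat \<Rightarrow> nat \<Rightarrow> (int \<times> int) list \<Rightarrow> int \<times> int \<Rightarrow> code set" where
  "cell m N w = (\<lambda>(r, s). {z \<in> Codes. map z [0..<N] = w \<and> inverse (real (Suc m)) \<le> \<bar>s - r * slope z\<bar>})"

lemma compact_cell_image:
  assumes "closedin (top_of_set Codes) (Codes \<inter> E)"
  shows "compact ((\<lambda>z. real_of_int r * first_num z + real_of_int s * second_num z) ` (cell m N w (r, s) \<inter> E))"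
proof (rule compact_continuous_image)
  have sub: "cell m N w (r, s) \<inter> E \<subseteq> Codes" by (auto simp: cell_def)
  show "continuous_on (cell m N w (r, s) \<inter> E) (\<lambda>z. real_of_int r * first_num z + real_of_int s * second_num z)"
    by (intro continuous_intros continuous_on_subset[OF _ sub] continuous_on_numbers)
  have "closed {z :: code. map z [0..<N] = w}"
  proof -
    have "continuous_on UNIV (\<lambda>z :: code. if map z [0..<N] = w then 0 else 1 :: real)"
    proof (rule continuous_on_causal)
      fix z z' :: code assume "\<And>j. j < N \<Longrightarrow> z j = z' j"
      then have "map z [0..<N] = map z' [0..<N]" by simp
      then show "(if map z [0..<N] = w then 0 else 1 :: real) = (if map z' [0..<N] = w then 0 else 1)"
        by (simp only:)
    qed
    then have "closed {z :: code. (if map z [0..<N] = w then 0 else 1 :: real) = 0}"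
      by (intro closed_Collect_eq continuous_on_const)
    moreover have "{z :: code. (if map z [0..<N] = w then 0 else 1 :: real) = 0} = {z. map z [0..<N] = w}"
      by auto
    ultimately show ?thesis by (simp only:)
  qed
  moreover have "closedin (top_of_set Codes) {z \<in> Codes. inverse (real (Suc m)) \<le> \<bar>s - r * slope z\<bar>}"
  proof -
    have "continuous_on Codes (\<lambda>z. \<bar>s - r * slope z\<bar>)"
      by (intro continuous_intros continuous_on_numbers)
    then have "closedin (top_of_set Codes) (Codes \<inter> (\<lambda>z. \<bar>s - r * slope z\<bar>) -` {inverse (real (Suc m))..})"
      by (rule continuous_closedin_preimage) simp
    moreover have "Codes \<inter> (\<lambda>z. \<bar>s - r * slope z\<bar>) -` {inverse (real (Suc m))..}
        = {z \<in> Codes. inverse (real (Suc m)) \<le> \<bar>s - r * slope z\<bar>}" by auto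
    ultimately show ?thesis by simp
  qed
  then have "compact ((Codes \<inter> E) \<inter> {z \<in> Codes. inverse (real (Suc m)) \<le> \<bar>s - r * slope z\<bar>})"
    by (intro closedin_compact[OF compact_Codes] closedin_Int assms)
  ultimately have "compact ({z. map z [0..<N] = w} \<inter>
      ((Codes \<inter> E) \<inter> {z \<in> Codes. inverse (real (Suc m)) \<le> \<bar>s - r * slope z\<bar>}))"
    by (rule closed_Int_compact)
  also have "{z. map z [0..<N] = w} \<inter>
      ((Codes \<inter> E) \<inter> {z \<in> Codes. inverse (real (Suc m)) \<le> \<bar>s - r * slope z\<bar>})
      = cell m N w (r, s) \<inter> E"
    by (auto simp: cell_def)
  finally show "compact (cell m N w (r, s) \<inter> E)" .
qed

text \<open>
  The table \<open>L\<close> attaches coefficients to the prescribed prefixes, and the code with prefix \<open>w0\<close> is the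
  one required to lie in \<open>E\<close>. All parameters are finite objects, hence countable in number.
\<close>
definition piece :: "code set \<Rightarrow> nat \<times> nat \<times> nat \<times> ((int \<times> int) list \<times> int \<times> int) list \<times> (int \<times> int) list \<Rightarrow> real set" where
  "piece E = (\<lambda>(D, m, N, L, w0). (\<lambda>x. x / real D) ` {\<Sum>w\<in>dom (map_of L). \<phi> w | \<phi>. \<forall>w\<in>dom (map_of L).
     \<phi> w \<in> (case the (map_of L w) of (r, s) \<Rightarrow> (\<lambda>z. real_of_int r * first_num z + real_of_int s * second_num z) `
        (cell m N w (r, s) \<inter> (if w = w0 then E else UNIV)))})"

lemma compact_piece:
  assumes "closedin (top_of_set Codes) (Codes \<inter> E)"
  shows "compact (piece E i)"
proof -
  obtain D m N L w0 where i: "i = (D, m, N, L, w0)" by (metis prod_cases5)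
  have cont: "continuous_on S (\<lambda>x. x / real D)" for S
    unfolding divide_inverse by (intro continuous_intros)
  show ?thesis
    unfolding piece_def i prod.case
  proof (intro compact_continuous_image[OF cont] compact_sumset)
    fix w :: "(int \<times> int) list"
    show "compact (case the (map_of L w) of (r, s) \<Rightarrow> (\<lambda>z. real_of_int r * first_num z + real_of_int s * second_num z) `
        (cell m N w (r, s) \<inter> (if w = w0 then E else UNIV)))"
      using compact_cell_image[of "if w = w0 then E else UNIV"] assms
      by (cases "the (map_of L w)") auto
  qed (auto simp: finite_dom_map_of)
qed

lemma quotients_meeting_eq_pieces:
  "quotients_meeting E = (\<Union>i\<in>{(D, m, N, L, w0). D > 0 \<and> w0 \<in> dom (map_of L)}. piece E i)"
proof (intro equalityI subsetI)
  fix c assume "c \<in> quotients_meeting E"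
  then obtain D I r s where c: "c = comb I r s / real D" "D > 0" "admissible I r s" "I \<inter> E \<noteq> {}"
    unfolding quotients_meeting_def by blast
  then have I: "finite I" "I \<subseteq> Codes" "\<And>z. z \<in> I \<Longrightarrow> s z \<noteq> r z * slope z"
    by (auto simp: admissible_def)
  obtain z0 where z0: "z0 \<in> I" "z0 \<in> E" using c(4) by blast
  obtain N where inj: "inj_on (\<lambda>z. map z [0..<N]) I"
    using prefixes_separate[OF I(1)] .
  define pre where "pre z = map z [0..<N]" for z :: code
  have inv: "inv_into I pre (pre z) = z" if "z \<in> I" for z
    using inj that by (intro inv_into_f_f) (simp_all add: pre_def[abs_def])
  obtain L where L: "dom (map_of L) = pre ` I"
    "\<forall>w\<in>pre ` I. map_of L w = Some (r (inv_into I pre w), s (inv_into I pre w))"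
    using finite_map_of[OF finite_imageI[OF I(1), of pre],
        of "\<lambda>w. (r (inv_into I pre w), s (inv_into I pre w))"] by blast
  have "\<forall>\<^sub>F m in sequentially. \<forall>z\<in>I. inverse (real (Suc m)) \<le> \<bar>s z - r z * slope z\<bar>"
  proof (intro eventually_ball_finite ballI I(1))
    fix z assume "z \<in> I"
    then have "0 < \<bar>s z - r z * slope z\<bar>" using I(3) by simp
    then have "\<forall>\<^sub>F m in sequentially. inverse (real (Suc m)) < \<bar>s z - r z * slope z\<bar>"
      by (rule order_tendstoD(2)[OF LIMSEQ_inverse_real_of_nat])
    then show "\<forall>\<^sub>F m in sequentially. inverse (real (Suc m)) \<le> \<bar>s z - r z * slope z\<bar>"
      by (rule eventually_mono) simp
  qed
  then obtain m where m: "\<And>z. z \<in> I \<Longrightarrow> inverse (real (Suc m)) \<le> \<bar>s z - r z * slope z\<bar>"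
    unfolding eventually_sequentially by blast
  define \<phi> where "\<phi> w = (let z = inv_into I pre w in r z * first_num z + s z * second_num z)" for w
  have "comb I r s = (\<Sum>w\<in>dom (map_of L). \<phi> w)"
  proof -
    have "(\<Sum>w\<in>pre ` I. \<phi> w) = (\<Sum>z\<in>I. \<phi> (pre z))"
      using inj by (subst sum.reindex) (simp_all add: pre_def[abs_def])
    also have "\<dots> = comb I r s"
      unfolding comb_def by (rule sum.cong) (simp_all add: \<phi>_def inv)
    finally show ?thesis by (simp add: L(1))
  qed
  moreover have "\<phi> w \<in> (case the (map_of L w) of (r, s) \<Rightarrow> (\<lambda>z. real_of_int r * first_num z + real_of_int s * second_num z) `
        (cell m N w (r, s) \<inter> (if w = pre z0 then E else UNIV)))" if w: "w \<in> dom (map_of L)" for w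
  proof -
    obtain z where z: "z \<in> I" "w = pre z" using w L(1) by auto
    have "z \<in> cell m N w (r z, s z)"
      using z I(2) m by (auto simp: cell_def pre_def)
    moreover have "z \<in> E" if "w = pre z0"
      using inv[OF z(1)] inv[OF z0(1)] that z z0 by metis
    moreover have "map_of L w = Some (r z, s z)"
      using L(2) z inv by simp
    ultimately show ?thesis
      by (auto simp: \<phi>_def z(2) inv[OF z(1)] Let_def)
  qed
  ultimately have "c \<in> piece E (D, m, N, L, pre z0)"
    unfolding piece_def prod.case c(1) by (intro imageI CollectI exI[of _ \<phi>] conjI ballI)
  then show "c \<in> (\<Union>i\<in>{(D, m, N, L, w0). D > 0 \<and> w0 \<in> dom (map_of L)}. piece E i)"
    using c(2) L(1) z0(1) by fastforce
next
  fix c assume "c \<in> (\<Union>i\<in>{(D, m, N, L, w0). D > 0 \<and> w0 \<in> dom (map_of L)}. piece E i)"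
  then obtain i where i: "i \<in> {(D, m, N, L, w0). D > 0 \<and> w0 \<in> dom (map_of L)}" "c \<in> piece E i"
    by blast
  obtain D m N L w0 where "i = (D, m, N, L, w0)" by (metis prod_cases5)
  with i have D: "D > 0" and w0: "w0 \<in> dom (map_of L)"
    and "c \<in> piece E (D, m, N, L, w0)" by simp_all
  then obtain \<phi> where c: "c = (\<Sum>w\<in>dom (map_of L). \<phi> w) / real D"
    and \<phi>: "\<forall>w\<in>dom (map_of L). \<phi> w \<in> (case the (map_of L w) of (r, s) \<Rightarrow>
        (\<lambda>z. real_of_int r * first_num z + real_of_int s * second_num z) `
        (cell m N w (r, s) \<inter> (if w = w0 then E else UNIV)))"
    unfolding piece_def prod.case by blast
  define R S where "R w = fst (the (map_of L w))" and "S w = snd (the (map_of L w))" for w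
  have "\<forall>w\<in>dom (map_of L). \<exists>z. z \<in> cell m N w (R w, S w) \<and> (w = w0 \<longrightarrow> z \<in> E) \<and>
      \<phi> w = R w * first_num z + S w * second_num z"
  proof
    fix w assume "w \<in> dom (map_of L)"
    then have "\<phi> w \<in> (case the (map_of L w) of (r, s) \<Rightarrow>
        (\<lambda>z. real_of_int r * first_num z + real_of_int s * second_num z) `
        (cell m N w (r, s) \<inter> (if w = w0 then E else UNIV)))" by (rule bspec[OF \<phi>])
    then show "\<exists>z. z \<in> cell m N w (R w, S w) \<and> (w = w0 \<longrightarrow> z \<in> E) \<and>
      \<phi> w = R w * first_num z + S w * second_num z"
      by (auto simp: R_def S_def split: prod.splits)
  qed
  then obtain \<zeta> where \<zeta>: "\<And>w. w \<in> dom (map_of L) \<Longrightarrow> \<zeta> w \<in> cell m N w (R w, S w)"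
    "w0 \<in> dom (map_of L) \<Longrightarrow> \<zeta> w0 \<in> E"
    "\<And>w. w \<in> dom (map_of L) \<Longrightarrow> \<phi> w = R w * first_num (\<zeta> w) + S w * second_num (\<zeta> w)"
    by metis
  define I where "I = \<zeta> ` dom (map_of L)"
  define r s where "r z = R (map z [0..<N])" and "s z = S (map z [0..<N])" for z :: code
  have pre: "map (\<zeta> w) [0..<N] = w" if "w \<in> dom (map_of L)" for w
    using \<zeta>(1)[OF that] by (simp add: cell_def)
  have "inj_on \<zeta> (dom (map_of L))"
    by (metis inj_onI pre)
  then have "comb I r s = (\<Sum>w\<in>dom (map_of L). \<phi> w)"
    unfolding comb_def I_def
    by (subst sum.reindex) (auto intro!: sum.cong simp: r_def s_def pre \<zeta>(3))
  moreover have "admissible I r s"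
    unfolding admissible_def
  proof (intro conjI ballI)
    show "finite I" by (simp add: I_def finite_dom_map_of)
    show "I \<subseteq> Codes" using \<zeta>(1) by (auto simp: I_def cell_def)
    fix z assume "z \<in> I"
    then obtain w where w: "w \<in> dom (map_of L)" "z = \<zeta> w" by (auto simp: I_def)
    have "inverse (real (Suc m)) \<le> \<bar>S w - R w * slope z\<bar>"
      using \<zeta>(1)[OF w(1)] w(2) by (simp add: cell_def)
    moreover have "0 < inverse (real (Suc m))" by simp
    ultimately have "S w - R w * slope z \<noteq> 0" by linarith
    then show "real_of_int (s z) \<noteq> r z * slope z"
      using pre[OF w(1)] by (simp add: r_def s_def w(2))
  qed
  moreover have "I \<inter> E \<noteq> {}"
    using w0 \<zeta>(2) by (auto simp: I_def)
  ultimately show "c \<in> quotients_meeting E"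
    unfolding quotients_meeting_def c using D
    by (intro CollectI exI[of _ D] exI[of _ I] exI[of _ r] exI[of _ s]) simp
qed

lemma fsigma_quotients_meeting: "closedin (top_of_set Codes) (Codes \<inter> E) \<Longrightarrow> fsigma (quotients_meeting E)"
  unfolding quotients_meeting_eq_pieces
  by (intro fsigma_UN_closed compact_imp_closed compact_piece) auto


section \<open>The subspace\<close>
definition witness :: "real set" where
  "witness = {comb I r s / real D | D I r s. D > 0 \<and> finite I \<and> I \<subseteq> Codes \<and> (\<forall>z\<in>I. slope z \<notin> \<rat>)}"

lemma comb_extend:
  assumes "finite J" "I \<subseteq> J"
  shows "comb J (\<lambda>z. if z \<in> I then r z else 0) (\<lambda>z. if z \<in> I then s z else 0) = comb I r s"
  unfolding comb_def using assms by (intro sum.mono_neutral_cong_right) auto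

lemma comb_linear:
  "comb J (\<lambda>z. m * r z + n * r' z) (\<lambda>z. m * s z + n * s' z) = m * comb J r s + n * comb J r' s'"
  by (simp add: comb_def algebra_simps sum.distrib sum_distrib_left)

lemma comb_restrict:
  assumes "finite J"
  shows "comb {z \<in> J. r z \<noteq> 0 \<or> s z \<noteq> 0} r s = comb J r s"
  unfolding comb_def using assms by (intro sum.mono_neutral_left) auto

lemma irrational_slope_ne:
  assumes "slope z \<notin> \<rat>" "r \<noteq> 0 \<or> s \<noteq> 0"
  shows "real_of_int s \<noteq> real_of_int r * slope z"
proof
  assume *: "real_of_int s = real_of_int r * slope z"
  with assms(2) have "r \<noteq> 0" by auto
  with * have "slope z = real_of_int s / real_of_int r" by (simp add: field_simps)
  then show False using assms(1) by auto
qed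

lemma witness_subset: "witness \<subseteq> insert 0 (quotients_meeting UNIV)"
proof
  fix c assume "c \<in> witness"
  then obtain D I r s where c: "c = comb I r s / real D" "D > 0" "finite I" "I \<subseteq> Codes"
    "\<forall>z\<in>I. slope z \<notin> \<rat>" unfolding witness_def by blast
  define J where "J = {z \<in> I. r z \<noteq> 0 \<or> s z \<noteq> 0}"
  have "admissible J r s"
    unfolding admissible_def using c(3-5) irrational_slope_ne by (auto simp: J_def)
  moreover have cJ: "c = comb J r s / real D"
    using c(1) comb_restrict[OF c(3), of r s, folded J_def] by simp
  ultimately show "c \<in> insert 0 (quotients_meeting UNIV)"
  proof (cases "J = {}")
    case False
    then show ?thesis
      using \<open>admissible J r s\<close> c(2) cJ by (auto simp: quotients_meeting_def)
  qed (simp add: comb_def)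
qed

text \<open>
  Subtract the two representations. A code of rational slope in the second one is not used in the first,
  so its coefficients survive and remain admissible; the codes of irrational slope are
  admissible as soon as their coefficients do not both vanish. Such a combination is not zero.
\<close>
lemma witness_disjoint:
  assumes E: "\<And>z. z \<in> E \<Longrightarrow> slope z \<in> \<rat>"
  shows "witness \<inter> quotients_meeting E = {}"
proof (rule equals0I)
  fix c assume "c \<in> witness \<inter> quotients_meeting E"
  then obtain D I r s D' J r' s' where
    c: "c = comb I r s / real D" "D > 0" "finite I" "I \<subseteq> Codes" "\<forall>z\<in>I. slope z \<notin> \<rat>" and
    c': "c = comb J r' s' / real D'" "D' > 0" "admissible J r' s'" "J \<inter> E \<noteq> {}"
    unfolding witness_def quotients_meeting_def by blast
  have J: "finite J" "J \<subseteq> Codes" "\<And>z. z \<in> J \<Longrightarrow> real_of_int (s' z) \<noteq> r' z * slope z"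
    using c'(3) by (auto simp: admissible_def)
  obtain z0 where z0: "z0 \<in> J" "slope z0 \<in> \<rat>" using c'(4) E by blast
  \<comment> \<open>Multiplying by \<open>D * D'\<close> makes the coefficients of the difference integral.\<close>
  define R S where
    "R z = int D' * (if z \<in> I then r z else 0) + (- int D) * (if z \<in> J then r' z else 0)" and
    "S z = int D' * (if z \<in> I then s z else 0) + (- int D) * (if z \<in> J then s' z else 0)" for z
  define U where "U = {z \<in> I \<union> J. R z \<noteq> 0 \<or> S z \<noteq> 0}"
  have "comb U R S = comb (I \<union> J) R S"
    unfolding U_def using c(3) J(1) by (intro comb_restrict) auto
  also have "\<dots> = int D' * comb I r s + (- int D) * comb J r' s'"
    unfolding R_def S_def comb_linear using c(3) J(1) by (simp add: comb_extend)
  also have "\<dots> = 0"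
    using c(1,2) c'(1,2) by (simp add: field_simps)
  finally have "comb U R S = 0" .
  moreover have rat: "real_of_int (S z) \<noteq> R z * slope z" if "z \<in> J" "slope z \<in> \<rat>" for z
  proof -
    have "z \<notin> I" using c(5) that by blast
    then show ?thesis using J(3)[OF that(1)] c(2) that by (simp add: R_def S_def)
  qed
  have "comb U R S \<noteq> 0"
  proof (rule comb_nonzero)
    show "finite U" "U \<subseteq> Codes" using c(3,4) J by (auto simp: U_def)
    show "z0 \<in> U" using rat[OF z0] z0 by (auto simp: U_def)
    fix z assume z: "z \<in> U"
    show "real_of_int (S z) \<noteq> R z * slope z"
    proof (cases "slope z \<in> \<rat>")
      case True
      then have "z \<in> J" using z c(5) by (auto simp: U_def)
      then show ?thesis using rat True by blast
    next
      case False
      then show ?thesis using z by (intro irrational_slope_ne) (auto simp: U_def)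
    qed
  qed
  ultimately show False by simp
qed

text \<open>
  The element 0 is listed separately because admissible combinations counted by
  \<open>quotients_meeting UNIV\<close> involve at least one code.
\<close>
lemma witness_difference:
  "witness = insert 0 (quotients_meeting UNIV) - (\<Union>q. quotients_meeting {z \<in> Codes. slope z = of_rat q})"
proof (intro equalityI subsetI)
  fix c assume "c \<in> witness"
  then show "c \<in> insert 0 (quotients_meeting UNIV) - (\<Union>q. quotients_meeting {z \<in> Codes. slope z = of_rat q})"
    using witness_subset witness_disjoint[of "{z \<in> Codes. slope z = of_rat q}" for q] by fastforce
next
  fix c assume c: "c \<in> insert 0 (quotients_meeting UNIV) - (\<Union>q. quotients_meeting {z \<in> Codes. slope z = of_rat q})"
  show "c \<in> witness"
  proof (cases "c = 0")
    case True
    then show ?thesis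
      unfolding witness_def by (intro CollectI exI[of _ 1] exI[of _ "{}"]) (auto simp: comb_def)
  next
    case False
    then obtain D I r s where I: "c = comb I r s / real D" "D > 0" "admissible I r s"
      using c unfolding quotients_meeting_def by blast
    have "slope z \<notin> \<rat>" if "z \<in> I" for z
    proof
      assume "slope z \<in> \<rat>"
      then obtain q where "slope z = of_rat q" by (rule Rats_cases)
      moreover have "z \<in> Codes" using I(3) that by (auto simp: admissible_def)
      ultimately have "c \<in> quotients_meeting {z \<in> Codes. slope z = of_rat q}"
        unfolding quotients_meeting_def using I that by blast
      then show False using c by blast
    qed
    then show ?thesis
      unfolding witness_def using I by (auto simp: admissible_def)
  qed
qed

lemma witness_subspace: "rat_real.subspace witness"
proof (rule rat_real.subspaceI)
  show "0 \<in> witness"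
    unfolding witness_def by (intro CollectI exI[of _ 1] exI[of _ "{}"]) (auto simp: comb_def)
next
  fix x y assume "x \<in> witness" "y \<in> witness"
  then obtain D I r s D' J r' s' where
    x: "x = comb I r s / real D" "D > 0" "finite I" "I \<subseteq> Codes" "\<forall>z\<in>I. slope z \<notin> \<rat>" and
    y: "y = comb J r' s' / real D'" "D' > 0" "finite J" "J \<subseteq> Codes" "\<forall>z\<in>J. slope z \<notin> \<rat>"
    unfolding witness_def by blast
  define R S where
    "R z = int D' * (if z \<in> I then r z else 0) + int D * (if z \<in> J then r' z else 0)" and
    "S z = int D' * (if z \<in> I then s z else 0) + int D * (if z \<in> J then s' z else 0)" for z
  have "comb (I \<union> J) R S = int D' * comb I r s + int D * comb J r' s'"
    unfolding R_def S_def comb_linear using x(3) y(3) by (simp add: comb_extend)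
  then have "x + y = comb (I \<union> J) R S / real (D * D')"
    using x(1,2) y(1,2) by (simp add: field_simps)
  then show "x + y \<in> witness"
    unfolding witness_def using x y
    by (intro CollectI exI[of _ "D * D'"] exI[of _ "I \<union> J"] exI[of _ R] exI[of _ S]) auto
next
  fix q :: rat and x assume "x \<in> witness"
  then obtain D I r s where
    x: "x = comb I r s / real D" "D > 0" "finite I" "I \<subseteq> Codes" "\<forall>z\<in>I. slope z \<notin> \<rat>"
    unfolding witness_def by blast
  obtain m n where q: "q = Fract m n" "n > 0" by (rule Rat_cases)
  have "comb I (\<lambda>z. m * r z) (\<lambda>z. m * s z) = m * comb I r s"
    using comb_linear[of I m r 0 r s s] by simp
  then have "of_rat q * x = comb I (\<lambda>z. m * r z) (\<lambda>z. m * s z) / real (nat n * D)"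
    using q x(1,2) by (simp add: of_rat_rat)
  then show "of_rat q * x \<in> witness"
    unfolding witness_def using x q
    by (intro CollectI exI[of _ "nat n * D"] exI[of _ I] exI) auto
qed

lemma witness_liouville_like:
  assumes "c \<in> witness"
  shows "liouville_like c"
proof -
  from assms obtain D I r s where c: "c = comb I r s / real D" "D > 0" "finite I" "I \<subseteq> Codes"
    "\<forall>z\<in>I. slope z \<notin> \<rat>" unfolding witness_def by blast
  define J where "J = {z \<in> I. r z \<noteq> 0 \<or> s z \<noteq> 0}"
  have "liouville_like (comb J r s / real D)"
    using c irrational_slope_ne by (intro comb_liouville_like) (auto simp: J_def)
  then show ?thesis using c(1) comb_restrict[OF c(3), of r s, folded J_def] by simp
qed

lemma code_numbers_in_witness:
  assumes "z \<in> Codes" "slope z \<notin> \<rat>"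
  shows "first_num z \<in> witness" "second_num z \<in> witness"
proof -
  have "first_num z = comb {z} (\<lambda>_. 1) (\<lambda>_. 0) / real 1" "second_num z = comb {z} (\<lambda>_. 0) (\<lambda>_. 1) / real 1"
    by (simp_all add: comb_def)
  then show "first_num z \<in> witness" "second_num z \<in> witness"
    unfolding witness_def using assms by fastforce+
qed

text \<open>
  For irrational \<open>\<xi>\<close> a code of slope \<open>frac \<xi>\<close> represents \<open>x / n\<close> with \<open>n\<close> large; multiplying by \<open>n\<close> and
  moving the integer part of \<open>\<xi>\<close> into the first summand represents \<open>x\<close>.
\<close>
lemma witness_X_set: "X_set witness = UNIV - \<rat>"
proof (intro equalityI subsetI)
  note sub = witness_subspace
  fix \<xi> assume \<xi>: "\<xi> \<in> X_set witness"
  show "\<xi> \<in> UNIV - \<rat>"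
  proof
    show "\<xi> \<notin> \<rat>"
    proof
      assume "\<xi> \<in> \<rat>"
      then obtain q where "\<xi> = of_rat q" by (rule Rats_cases)
      then have "{a + \<xi> * b | a b. a \<in> witness \<and> b \<in> witness} \<subseteq> witness"
        using sub by (auto intro!: rat_real.subspace_add rat_real.subspace_scale)
      then have "sqrt 2 \<in> witness"
        using \<xi> unfolding X_set_def by blast
      then show False
        using witness_liouville_like sqrt2_not_liouville_like by blast
    qed
  qed simp
next
  note sub = witness_subspace
  fix \<xi> :: real assume "\<xi> \<in> UNIV - \<rat>"
  then have \<xi>: "\<xi> \<notin> \<rat>" by simp
  have "\<exists>a b. x = a + \<xi> * b \<and> a \<in> witness \<and> b \<in> witness" for x
  proof -
    obtain n :: nat where n: "real n > \<bar>x\<bar> * scale 0" "n > 0"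
      by (metis gr0I of_nat_0 reals_Archimedean2 abs_ge_zero mult_nonneg_nonneg of_nat_0_le_iff not_less)
    have "\<bar>x / n\<bar> \<le> 1 / scale 0"
      using n by (simp add: field_simps)
    moreover have "0 \<le> frac \<xi>" "frac \<xi> < 1" by (simp_all add: frac_lt_1)
    ultimately obtain z where z: "z \<in> Codes" "slope z = frac \<xi>" "first_num z + frac \<xi> * second_num z = x / n"
      using greedy_representation by blast
    have "slope z \<notin> \<rat>"
      using \<xi> z(2) by (metis Rats_add Rats_of_int frac_def diff_add_cancel)
    then have ab: "first_num z \<in> witness" "second_num z \<in> witness"
      using code_numbers_in_witness z(1) by blast+
    have mult: "of_rat q * y \<in> witness" if "y \<in> witness" for q y
      using sub that by (rule rat_real.subspace_scale)
    have "of_rat (of_nat n) * first_num z - of_rat (of_nat n * of_int \<lfloor>\<xi>\<rfloor>) * second_num z \<in> witness"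
      using sub ab by (intro rat_real.subspace_diff mult)
    moreover have "of_rat (of_nat n) * second_num z \<in> witness"
      using ab by (intro mult)
    moreover have "x = (of_rat (of_nat n) * first_num z - of_rat (of_nat n * of_int \<lfloor>\<xi>\<rfloor>) * second_num z)
        + \<xi> * (of_rat (of_nat n) * second_num z)"
    proof -
      have "x = n * (first_num z + frac \<xi> * second_num z)" using z(3) n(2) by simp
      then show ?thesis by (simp add: frac_def of_rat_mult algebra_simps)
    qed
    ultimately show ?thesis by blast
  qed
  then show "\<xi> \<in> X_set witness"
    unfolding X_set_def by blast
qed

lemma rat_subspace_dense:
  assumes A: "rat_real.subspace A" and a: "a \<in> A" "a \<noteq> 0"
  shows "closure A = UNIV"
proof -
  have "y \<in> closure A" for y
    unfolding closure_approachable
  proof (intro allI impI)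
    fix e :: real assume e: "e > 0"
    obtain q where q: "y / a < of_rat q" "of_rat q < y / a + e / \<bar>a\<bar>"
      using of_rat_dense[of "y / a" "y / a + e / \<bar>a\<bar>"] e a by auto
    then have "\<bar>of_rat q - y / a\<bar> * \<bar>a\<bar> < e / \<bar>a\<bar> * \<bar>a\<bar>"
      using a(2) by (intro mult_strict_right_mono) auto
    then have "\<bar>of_rat q * a - y\<bar> < e"
      using a(2) by (simp add: left_diff_distrib flip: abs_mult)
    then show "\<exists>x\<in>A. dist x y < e"
      using rat_real.subspace_scale[OF A a(1), of q] by (auto simp: dist_real_def)
  qed
  then show ?thesis by blast
qed

theorem mainTheorem6:
  shows "\<exists>A :: real set.
           rat_real.subspace A \<and>
           hausdorff_dim A = 0 \<and>
           X_set A = UNIV - \<rat> \<and>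
           (\<exists>F\<^sub>1 F\<^sub>2. F\<^sub>1 \<in> Sigma02 \<and> F\<^sub>2 \<in> Sigma02 \<and> A = F\<^sub>1 - F\<^sub>2) \<and>
           A \<in> Delta03 - (Sigma02 \<union> Pi02)"
proof -
  have closed_slope: "closedin (top_of_set Codes) (Codes \<inter> {z \<in> Codes. slope z = of_rat q})" for q
  proof -
    have "closedin (top_of_set Codes) (Codes \<inter> slope -` {of_rat q})"
      by (rule continuous_closedin_preimage[OF continuous_on_numbers(3)]) simp
    moreover have "Codes \<inter> slope -` {of_rat q} = Codes \<inter> {z \<in> Codes. slope z = of_rat q}" by auto
    ultimately show ?thesis by (simp only:)
  qed
  have F1: "fsigma (insert 0 (quotients_meeting UNIV))"
  proof -
    have "fsigma_in euclidean (quotients_meeting UNIV)"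
      using fsigma_quotients_meeting[of UNIV] by (simp add: fsigma_iff_fsigma_in)
    then have "fsigma_in euclidean ({0} \<union> quotients_meeting UNIV)"
      by (intro fsigma_in_Un[OF closed_imp_fsigma_in]) auto
    then show ?thesis by (simp add: fsigma_iff_fsigma_in)
  qed
  have F2: "fsigma (\<Union>q. quotients_meeting {z \<in> Codes. slope z = of_rat q})"
    using fsigma_quotients_meeting[OF closed_slope]
    by (simp only: fsigma_iff_fsigma_in) (rule fsigma_in_Union, auto)
  have "witness \<noteq> {0}"
  proof
    assume *: "witness = {0}"
    have "uncountable (UNIV :: real set)" by (rule uncountable_UNIV_real)
    then obtain \<xi> :: real where "\<xi> \<notin> \<rat>"
      using countable_rat by (metis (full_types) UNIV_eq_I)
    then have "{a + \<xi> * b | a b. a \<in> witness \<and> b \<in> witness} = UNIV"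
      using witness_X_set unfolding X_set_def by blast
    then have "(1 :: real) \<in> {a + \<xi> * b | a b. a \<in> witness \<and> b \<in> witness}" by blast
    then obtain a b where "1 = a + \<xi> * b" "a \<in> witness" "b \<in> witness" by blast
    then show False unfolding * by simp
  qed
  then obtain a where "a \<in> witness" "a \<noteq> 0"
    using rat_real.subspace_0[OF witness_subspace] by blast
  then have "closure witness = UNIV"
    by (rule rat_subspace_dense[OF witness_subspace])
  moreover have "sqrt 2 \<notin> witness"
    using witness_liouville_like sqrt2_not_liouville_like by blast
  ultimately have "\<not> gdelta witness"
    using proper_dense_subgroup_not_gdelta rat_real.subspace_diff[OF witness_subspace] by blast
  moreover have "\<not> fsigma witness"
    by (rule irrational_X_set_not_fsigma[OF witness_subspace witness_X_set])
  moreover have "witness \<in> Delta03"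
    by (subst witness_difference) (rule diff_fsigma_Delta03[OF F1 F2])
  moreover have "hausdorff_dim witness = 0"
    by (rule liouville_hausdorff_dim) (rule witness_liouville_like)
  ultimately show ?thesis
    using witness_subspace witness_X_set witness_difference F1 F2
    unfolding Sigma02_def Pi02_def by blast
qed

end
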